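(* Let $A\in\mathbb{C}^{n\times n}$ be Hermitian positive definite, let $\mathbf{y},\mathbf{z}\in\mathbb{C}^n$ with $\|\mathbf{y}\|=\|\mathbf{z}\|=1$, and let $\eta\in\mathbb{C}$. Then the Arnoldi approximations $\bar L_m^{\mathrm{Arn}}$ of the Fréchet derivative $L_{\log}(A,\eta\mathbf{y}\mathbf{z}^H)$ of the matrix logarithm (defined in the context) satisfy $$\|L_{\log}(A,\eta\mathbf{y}\mathbf{z}^H)-\bar L_m^{\mathrm{Arn}}\|\le\frac{4|\eta|}{\lambda_{\min}}\left(\frac{\sqrt{\kappa}-1}{\sqrt{\kappa}+1}\right)^m,$$ where $\lambda_{\min}$ is the smallest eigenvalue of $A$ and $\kappa$ is the Euclidean norm condition number of $A$.
   Context: $\|\cdot\|$ is the Euclidean vector norm and the matrix 2-norm; ${}^H$ is the conjugate transpose; $\mathbf{e}_1$ is the first canonical unit vector of $\mathbb{C}^m$; $\log$ is the principal matrix logarithm. The Fréchet derivative $L_f(A,\cdot)$ of a matrix function $f$ at $A$ is the unique linear operator with $f(A+E)-f(A)=L_f(A,E)+o(\|E\|)$. Arnoldi approximation: let $\mathcal{K}_m(A,\mathbf{y})=\mathrm{span}\{\mathbf{y},A\mathbf{y},\dots,A^{m-1}\mathbf{y}\}$. Here $m\ge1$ is such that $\mathcal{K}_m(A,\mathbf{y})$ and $\mathcal{K}_m(A^H,\mathbf{z})$ both have dimension $m$. Let $V_m,W_m\in\mathbb{C}^{n\times m}$ have orthonormal columns forming bases of $\mathcal{K}_m(A,\mathbf{y})$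 and $\mathcal{K}_m(A^H,\mathbf{z})$ generated by the Arnoldi process, so that $V_m\mathbf{e}_1=\mathbf{y}/\|\mathbf{y}\|$, $W_m\mathbf{e}_1=\mathbf{z}/\|\mathbf{z}\|$, and let $G_m=V_m^HAV_m$, $H_m=W_m^HA^HW_m$. Then $$\bar L_m^{\mathrm{Arn}}:=\eta\,V_m\int_0^1\|\mathbf{y}\|\|\mathbf{z}\|\,\bigl(t(G_m-I)+I\bigr)^{-1}\mathbf{e}_1\mathbf{e}_1^H\bigl(t(H_m^H-I)+I\bigr)^{-1}dt\;W_m^H.$$ *)

theory Defs
  imports "HOL-Analysis.Analysis"
begin

text \<open>Matrices are \<open>complex^'c^'r\<close> (rows indexed by \<open>'r\<close>, columns by \<open>'c\<close>). The inherited
  \<open>norm\<close> on vectors is the Euclidean norm; on matrices it is the Frobenius norm, so the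
  matrix 2-norm is introduced separately as an operator norm.\<close>

definition norm2 :: "complex^'c^'r \<Rightarrow> real" where
  "norm2 M = onorm (\<lambda>x. M *v x)"

definition ctranspose :: "complex^'c^'r \<Rightarrow> complex^'r^'c" where
  "ctranspose M = map_matrix cnj (transpose M)"

definition smult_mat :: "complex \<Rightarrow> complex^'c^'r \<Rightarrow> complex^'c^'r" (infixr \<open>*sm\<close> 75) where
  "c *sm M = map_matrix ((*) c) M"

text \<open>\<open>cinner x y\<close> is $x^H y$ and \<open>outer x y\<close> is $x y^H$.\<close>

definition cinner :: "complex^'n \<Rightarrow> complex^'n \<Rightarrow> complex" where
  "cinner x y = (\<Sum>i\<in>UNIV. cnj (x $ i) * y $ i)"

definition outer :: "complex^'r \<Rightarrow> complex^'c \<Rightarrow> complex^'c^'r" where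
  "outer x y = (\<chi> i j. x $ i * cnj (y $ j))"

definition hermitian_mat :: "complex^'n^'n \<Rightarrow> bool" where
  "hermitian_mat A \<longleftrightarrow> ctranspose A = A"

definition hermitian_pos_def :: "complex^'n^'n \<Rightarrow> bool" where
  "hermitian_pos_def A \<longleftrightarrow>
     hermitian_mat A \<and> (\<forall>x. x \<noteq> 0 \<longrightarrow> Re (cinner x (A *v x)) > 0)"

definition eigenvalues :: "complex^'n^'n \<Rightarrow> complex set" where
  "eigenvalues A = {l. \<exists>x. x \<noteq> 0 \<and> A *v x = l *s x}"

text \<open>Meant for Hermitian matrices, all of whose eigenvalues are real.\<close>

definition lambda_min :: "complex^'n^'n \<Rightarrow> real" where
  "lambda_min A = Min (Re ` eigenvalues A)"

definition cond_num :: "complex^'n^'n \<Rightarrow> real" where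
  "cond_num A = norm2 A * norm2 (matrix_inv A)"

definition mat_pow :: "complex^'n^'n \<Rightarrow> nat \<Rightarrow> complex^'n^'n" where
  "mat_pow A k = (((**) A) ^^ k) (mat 1)"

definition mat_exp :: "complex^'n^'n \<Rightarrow> complex^'n^'n" where
  "mat_exp A = (\<Sum>k. mat_pow A k /\<^sub>R fact k)"

text \<open>For \<open>A\<close> without eigenvalues on the closed negative real axis, the principal logarithm
  is the unique logarithm whose spectrum lies in the open strip \<open>\<bar>Im \<mu>\<bar> < pi\<close>.\<close>

definition mat_log :: "complex^'n^'n \<Rightarrow> complex^'n^'n" where
  "mat_log A = (THE X. mat_exp X = A \<and> (\<forall>\<mu>\<in>eigenvalues X. - pi < Im \<mu> \<and> Im \<mu> < pi))"

text \<open>\<open>has_derivative\<close> only asks for real linearity, hence the additional condition of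
  homogeneity over the complex numbers. Its remainder is measured in the Frobenius norm, which
  is equivalent to the matrix 2-norm.\<close>

definition frechet_deriv ::
  "(complex^'n^'n \<Rightarrow> complex^'n^'n) \<Rightarrow> complex^'n^'n \<Rightarrow> complex^'n^'n \<Rightarrow> complex^'n^'n" where
  "frechet_deriv f A =
     (THE L. (\<forall>c E. L (c *sm E) = c *sm L E) \<and> (f has_derivative L) (at A))"

definition krylov :: "nat \<Rightarrow> complex^'n^'n \<Rightarrow> complex^'n \<Rightarrow> (complex^'n) set" where
  "krylov m A y = vec.span {mat_pow A k *v y | k. k < m}"

text \<open>The Arnoldi process: orthogonalise \<open>A v\<^sub>j\<close> against \<open>v\<^sub>0, \<dots>, v\<^sub>j\<close> and normalise.
  \<open>sgn r\<close> is \<open>r / norm r\<close>, and \<open>0\<close> in case of breakdown (\<open>r = 0\<close>).\<close>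

fun arnoldi_vec :: "complex^'n^'n \<Rightarrow> complex^'n \<Rightarrow> nat \<Rightarrow> complex^'n" where
  "arnoldi_vec A y 0 = sgn y"
| "arnoldi_vec A y (Suc j) =
     sgn (A *v arnoldi_vec A y j -
       (\<Sum>i\<in>{..j}. cinner (arnoldi_vec A y i) (A *v arnoldi_vec A y j) *s arnoldi_vec A y i))"

text \<open>The number \<open>m\<close> of Arnoldi steps is \<open>CARD('m)\<close>. The order on \<open>'m\<close> enumerates the columns:
  column \<open>k\<close> has (zero-based) number \<open>card {..<k}\<close>.\<close>

definition arnoldi_basis ::
  "complex^'n^'n \<Rightarrow> complex^'n \<Rightarrow> complex^'m::{finite,wellorder}^'n \<Rightarrow> bool" where
  "arnoldi_basis A y V \<longleftrightarrow>
     ctranspose V ** V = mat 1 \<and>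
     vec.span (columns V) = krylov CARD('m::{finite,wellorder}) A y \<and>
     (\<forall>k. column k V = arnoldi_vec A y (card {..<k}))"

definition e1 :: "complex^'m::{finite,wellorder}" where
  "e1 = axis (LEAST k. True) 1"

definition arnoldi_approx ::
  "complex^'n^'n \<Rightarrow> complex \<Rightarrow> complex^'n \<Rightarrow> complex^'n \<Rightarrow>
   complex^'m::{finite,wellorder}^'n \<Rightarrow> complex^'m::{finite,wellorder}^'n \<Rightarrow> complex^'n^'n" where
  "arnoldi_approx A \<eta> y z V W =
     (let G = ctranspose V ** A ** V;
          H = ctranspose W ** ctranspose A ** W
      in \<eta> *sm (V **
           integral {0..1} (\<lambda>t::real. (norm y * norm z) *\<^sub>R
             (matrix_inv (t *\<^sub>R (G - mat 1) + mat 1) ** outer e1 e1 **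
              matrix_inv (t *\<^sub>R (ctranspose H - mat 1) + mat 1)))
         ** ctranspose W))"

lemma scaleR_eq_smult: "a *\<^sub>R u = complex_of_real a *s (u :: complex^'n)"
  by (simp add: vec_eq_iff scaleR_conv_of_real[where 'a = complex])

lemma cinner_simps:
  "cinner x (u - w) = cinner x u - cinner x w"
  "cinner x (sum g B) = (\<Sum>b\<in>B. cinner x (g b))"
  "cinner x (c *s u) = c * cinner x u"
  "cinner x (a *\<^sub>R u) = of_real a * cinner x u"
  "cinner 0 u = 0"
proof -
  show "cinner x (sum g B) = (\<Sum>b\<in>B. cinner x (g b))"
    unfolding cinner_def by (subst sum.swap) (simp add: sum_distrib_left)
  show "cinner x (a *\<^sub>R u) = of_real a * cinner x u"
    unfolding scaleR_eq_smult by (simp add: cinner_def sum_distrib_left mult.left_commute)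
qed (auto simp: cinner_def algebra_simps sum_subtractf sum_distrib_left)

lemma cinner_commute: "cinner x u = cnj (cinner u x)"
  by (simp add: cinner_def mult.commute)

lemma cinner_self: "cinner x x = of_real ((norm x)\<^sup>2)"
  by (simp add: cinner_def norm_vec_def L2_set_def sum_nonneg mult.commute
      flip: complex_norm_square)

declare arnoldi_vec.simps [simp del]

lemma norm_arnoldi_vec: "arnoldi_vec A y j = 0 \<or> norm (arnoldi_vec A y j) = 1"
proof -
  obtain u where "arnoldi_vec A y j = sgn u" by (cases j) (metis arnoldi_vec.simps)+
  then show ?thesis by (simp add: norm_sgn)
qed

lemma arnoldi_vec_orthogonal:
  "i < j \<Longrightarrow> cinner (arnoldi_vec A y i) (arnoldi_vec A y j) = 0"
proof (induction j arbitrary: i rule: less_induct)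
  case (less j)
  then obtain k where j: "j = Suc k" by (cases j) auto
  let ?v = "arnoldi_vec A y" and ?w = "A *v arnoldi_vec A y k"
  have "cinner (?v i) (cinner (?v l) ?w *s ?v l) = (if l = i then cinner (?v i) ?w else 0)"
    if "l \<le> k" for l
  proof (cases "l = i")
    case True
    show ?thesis using norm_arnoldi_vec[of A y i] True
      by (auto simp: cinner_simps(3,5) cinner_self)
  next
    case False
    then consider "l < i" | "i < l" by linarith
    then have "cinner (?v i) (?v l) = 0"
      using less.IH[of i l] less.IH[of l i] less.prems j that
      by cases (auto simp: cinner_commute[of "?v i" "?v l"])
    then show ?thesis using False by (simp add: cinner_simps)
  qed
  then have "cinner (?v i) (?w - (\<Sum>l\<in>{..k}. cinner (?v l) ?w *s ?v l)) = 0"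
    using less.prems j by (simp add: cinner_simps(1,2))
  then show ?case unfolding j arnoldi_vec.simps(2) sgn_div_norm cinner_simps(4) by simp
qed

lemma arnoldi_vec_span_step:
  assumes "x \<in> vec.span (arnoldi_vec A y ` {..j})"
  shows "A *v x \<in> vec.span (arnoldi_vec A y ` {..Suc j})"
proof -
  let ?v = "arnoldi_vec A y"
  have base: "A *v ?v i \<in> vec.span (?v ` {..Suc j})" if "i \<le> j" for i
  proof -
    define s where "s = (\<Sum>l\<in>{..i}. cinner (?v l) (A *v ?v i) *s ?v l)"
    define r where "r = A *v ?v i - s"
    have "r = of_real (norm r) *s sgn r"
      by (cases "r = 0") (auto simp: sgn_div_norm simp flip: scaleR_eq_smult)
    also have "sgn r = ?v (Suc i)" by (simp add: r_def s_def arnoldi_vec.simps)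
    finally have "r \<in> vec.span (?v ` {..Suc j})"
      using that by (metis Suc_le_mono atMost_iff imageI vec.span_base vec.span_scale)
    moreover have "s \<in> vec.span (?v ` {..Suc j})" unfolding s_def using that
      by (intro vec.span_sum vec.span_scale vec.span_base) auto
    moreover have "A *v ?v i = r + s" by (simp add: r_def)
    ultimately show ?thesis by (simp add: vec.span_add)
  qed
  have "(*v) A ` vec.span (?v ` {..j}) = vec.span ((*v) A ` ?v ` {..j})"
    by (simp add: vec.span_image)
  also have "\<dots> \<subseteq> vec.span (?v ` {..Suc j})"
    by (rule vec.span_minimal) (use base vec.subspace_span in auto)
  finally show ?thesis using assms by blast
qed

lemma krylov_subset_arnoldi: "krylov m A y \<subseteq> vec.span (arnoldi_vec A y ` {..<m})"
proof -
  have "mat_pow A k *v y \<in> vec.span (arnoldi_vec A y ` {..k})" for k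
  proof (induction k)
    case 0
    have "y = of_real (norm y) *s sgn y"
      by (cases "y = 0") (auto simp: sgn_div_norm simp flip: scaleR_eq_smult)
    then have "y \<in> vec.span {sgn y}" by (metis singletonI vec.span_base vec.span_scale)
    then show ?case by (simp add: mat_pow_def arnoldi_vec.simps)
  next
    case (Suc k)
    then show ?case using arnoldi_vec_span_step[OF Suc]
      by (simp add: mat_pow_def matrix_vector_mul_assoc)
  qed
  then have "mat_pow A k *v y \<in> vec.span (arnoldi_vec A y ` {..<m})" if "k < m" for k
    using that vec.span_mono[of "arnoldi_vec A y ` {..k}" "arnoldi_vec A y ` {..<m}"]
      image_mono[of "{..k}" "{..<m}" "arnoldi_vec A y"]
    by fastforce
  then show ?thesis unfolding krylov_def
    by (intro vec.span_minimal) auto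
qed

lemma bij_betw_card_lessThan:
  "bij_betw (\<lambda>k::'m::{finite,wellorder}. card {..<k}) UNIV {..<CARD('m)}"
proof -
  let ?f = "\<lambda>k::'m. card {..<k}"
  have "strict_mono ?f"
    by (rule strict_monoI) (auto intro!: psubset_card_mono)
  then have inj: "inj ?f" by (rule strict_mono_imp_inj_on)
  have "?f ` UNIV \<subseteq> {..<CARD('m)}" by (auto intro!: psubset_card_mono)
  moreover have "card (?f ` UNIV) = CARD('m)" using inj by (rule card_image)
  ultimately have "?f ` UNIV = {..<CARD('m)}" by (intro card_subset_eq) auto
  with inj show ?thesis by (simp add: bij_betw_def)
qed

text \<open>The first two clauses of \<^const>\<open>arnoldi_basis\<close> follow from the third one as long as the
  Krylov space has full dimension, so that an Arnoldi basis then exists and is unique.\<close>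

lemma arnoldi_basis_iff:
  fixes V :: "complex^'m::{finite,wellorder}^'n"
  assumes dim: "vec.dim (krylov CARD('m::{finite,wellorder}) A y) = CARD('m)"
  shows "arnoldi_basis A y V \<longleftrightarrow> (\<forall>k. column k V = arnoldi_vec A y (card {..<k}))"
proof
  assume cols: "\<forall>k. column k V = arnoldi_vec A y (card {..<k})"
  let ?v = "arnoldi_vec A y" and ?m = "CARD('m)"
  have c: "columns V = ?v ` {..<?m}"
  proof -
    have "columns V = ?v ` range (\<lambda>k::'m. card {..<k})" using cols by (auto simp: columns_def)
    then show ?thesis
      using bij_betw_card_lessThan[where ?'m = 'm] by (simp add: bij_betw_def)
  qed
  have le: "vec.dim (vec.span (?v ` {..<?m})) \<le> ?m"
    using vec.dim_le_card'[of "?v ` {..<?m}"] card_image_le[of "{..<?m}" ?v] by simp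
  have span: "vec.span (columns V) = krylov ?m A y"
    unfolding c by (rule vec.subspace_dim_equal[symmetric])
      (use krylov_subset_arnoldi[of ?m A y] le dim in \<open>auto simp: krylov_def\<close>)
  have nz: "?v j \<noteq> 0" if "j < ?m" for j
  proof
    assume "?v j = 0"
    then have "vec.span (?v ` {..<?m}) \<subseteq> vec.span (?v ` ({..<?m} - {j}))"
      by (intro vec.span_minimal) (auto intro: vec.span_base vec.span_zero, metis vec.span_base vec.span_zero imageI Diff_iff lessThan_iff singletonD)
    then have "krylov ?m A y \<subseteq> vec.span (?v ` ({..<?m} - {j}))" using span c by simp
    then have "?m \<le> card (?v ` ({..<?m} - {j}))"
      using vec.dim_subset[of "krylov ?m A y"] vec.dim_le_card'[of "?v ` ({..<?m} - {j})"] dim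
      by (metis (no_types, lifting) finite_Diff finite_imageI finite_lessThan le_trans vec.dim_span)
    also have "\<dots> \<le> card ({..<?m} - {j})" by (rule card_image_le) auto
    also have "\<dots> < ?m" using that by simp
    finally show False by simp
  qed
  have "(ctranspose V ** V) $ a $ b = mat 1 $ a $ b" for a b
  proof -
    have "(ctranspose V ** V) $ a $ b = cinner (column a V) (column b V)"
      by (simp add: ctranspose_def matrix_matrix_mult_def cinner_def column_def transpose_def map_matrix_def)
    also have "\<dots> = cinner (?v (card {..<a})) (?v (card {..<b}))" using cols by simp
    also have "\<dots> = mat 1 $ a $ b"
    proof (cases a b rule: linorder_cases)
      case less
      then have "card {..<a} < card {..<b}" by (auto intro!: psubset_card_mono)
      then show ?thesis using less by (simp add: arnoldi_vec_orthogonal mat_def)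
    next
      case greater
      then have "card {..<b} < card {..<a}" by (auto intro!: psubset_card_mono)
      then show ?thesis using greater cinner_commute[of "?v (card {..<a})" "?v (card {..<b})"]
        by (simp add: arnoldi_vec_orthogonal mat_def)
    next
      case equal
      have "card {..<a} < ?m" by (auto intro!: psubset_card_mono)
      then show ?thesis using equal nz[of "card {..<a}"] norm_arnoldi_vec[of A y "card {..<a}"]
        by (simp add: cinner_self mat_def)
    qed
    finally show ?thesis .
  qed
  then have "ctranspose V ** V = mat 1" by (simp add: vec_eq_iff)
  with span cols show "arnoldi_basis A y V" by (simp add: arnoldi_basis_def)
qed (simp add: arnoldi_basis_def)

end

theory Submission
  imports Defs "HOL-Computational_Algebra.Fundamental_Theorem_Algebra"
begin

text \<open>Write \<open>A\<^sub>t = t (A - I) + I\<close>. The derivative of the logarithm is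
  \<open>E \<mapsto> \<integral>\<^sub>0\<^sup>1 A\<^sub>t\<^sup>-\<^sup>1 E A\<^sub>t\<^sup>-\<^sup>1 dt\<close>, so for \<open>E = \<eta> y z\<^sup>H\<close> the integrand is the outer product of
  \<open>u = A\<^sub>t\<^sup>-\<^sup>1 y\<close> and \<open>w = A\<^sub>t\<^sup>-\<^sup>1 z\<close>. Since \<open>V\<^sup>H A\<^sub>t V = t (G - I) + I\<close>, the Arnoldi
  approximation replaces \<open>u\<close> and \<open>w\<close> by their Galerkin (conjugate gradient) approximations in the
  Krylov spaces of \<open>A\<close>, whose errors are at most \<open>2 q\<^sup>m / \<alpha>\<^sub>t\<close> by the Chebyshev bound, where \<open>\<alpha>\<^sub>t = t (\<lambda>\<^sub>m\<^sub>i\<^sub>n - 1) + 1\<close> and \<open>q\<close> is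
  the rate in the theorem (the condition number of \<open>A\<^sub>t\<close> does not exceed that of \<open>A\<close>). All four
  vectors have norm at most \<open>1 / \<alpha>\<^sub>t\<close>, hence the error is at most
  \<open>\<bar>\<eta>\<bar> \<integral>\<^sub>0\<^sup>1 4 q\<^sup>m / \<alpha>\<^sub>t\<^sup>2 dt = 4 \<bar>\<eta>\<bar> q\<^sup>m / \<lambda>\<^sub>m\<^sub>i\<^sub>n\<close>.

  The integral \<open>Log B = \<integral>\<^sub>0\<^sup>1 (B - I) B\<^sub>t\<^sup>-\<^sup>1 dt\<close> is identified with the principal logarithm as
  follows. The identity \<open>Log B' - Log B = \<integral>\<^sub>0\<^sup>1 B\<^sub>t\<^sup>-\<^sup>1 (B' - B) B'\<^sub>t\<^sup>-\<^sup>1 dt\<close> yields the derivative of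
  \<open>Log\<close>, and along \<open>s \<mapsto> exp (s Y)\<close> it shows \<open>Log (exp Y) = Y\<close> if the spectrum of \<open>Y\<close> lies in the
  strip. For \<open>C = exp (Log B)\<close> this gives \<open>Log C = Log B\<close>, and the same identity forces \<open>C = B\<close>.\<close>

section \<open>Complex matrices\<close>

lemma norm_vector_smult: "norm (c *s x) = cmod c * norm x" for x :: "complex^'n"
  by (simp add: norm_vec_def norm_mult L2_set_right_distrib)

lemma norm_matrix_vector_mult_le: "norm (M *v x) \<le> norm M * norm x"
  for M :: "complex^'n^'m"
proof -
  have "norm ((M *v x) $ i) \<le> norm (M $ i) * norm x" for i
  proof -
    have "norm ((M *v x) $ i) \<le> (\<Sum>j\<in>UNIV. norm (M $ i $ j) * norm (x $ j))"
      by (simp add: matrix_vector_mult_def norm_mult sum_norm_le)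
    also have "\<dots> \<le> norm (M $ i) * norm x"
      using L2_set_mult_ineq[of "\<lambda>j. norm (M $ i $ j)" "\<lambda>j. norm (x $ j)" UNIV]
      by (simp add: norm_vec_def)
    finally show ?thesis .
  qed
  then have "norm (M *v x) \<le> L2_set (\<lambda>i. norm (M $ i) * norm x) UNIV"
    unfolding norm_vec_def[of "M *v x"] by (intro L2_set_mono) auto
  also have "\<dots> = norm M * norm x"
    by (simp add: norm_vec_def[of M] L2_set_left_distrib)
  finally show ?thesis .
qed

lemma norm_matrix_mult_le: "norm (M ** N) \<le> norm M * norm N"
  for M :: "complex^'n^'m" and N :: "complex^'p^'n"
proof -
  have "norm ((M ** N) $ i) \<le> norm (M $ i) * norm N" for i
  proof -
    have "(M ** N) $ i = (\<Sum>k\<in>UNIV. M $ i $ k *s N $ k)"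
      by (simp add: matrix_matrix_mult_def vec_eq_iff)
    then have "norm ((M ** N) $ i) \<le> (\<Sum>j\<in>UNIV. norm (M $ i $ j) * norm (N $ j))"
      by (simp add: norm_vector_smult sum_norm_le)
    also have "\<dots> \<le> norm (M $ i) * norm N"
      using L2_set_mult_ineq[of "\<lambda>j. norm (M $ i $ j)" "\<lambda>j. norm (N $ j)" UNIV]
      by (simp add: norm_vec_def)
    finally show ?thesis .
  qed
  then have "norm (M ** N) \<le> L2_set (\<lambda>i. norm (M $ i) * norm N) UNIV"
    unfolding norm_vec_def[of "M ** N"] by (intro L2_set_mono) auto
  also have "\<dots> = norm M * norm N"
    by (simp add: norm_vec_def[of M] L2_set_left_distrib)
  finally show ?thesis .
qed

lemma matrix_mult_minus_left: "(A - B) ** C = A ** C - B ** C"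
  for A :: "'a::ring_1^'n^'m"
  by (vector matrix_matrix_mult_def sum_subtractf left_diff_distrib)

lemma matrix_mult_minus_right: "A ** (B - C) = A ** B - A ** C"
  for A :: "'a::ring_1^'n^'m"
  by (vector matrix_matrix_mult_def sum_subtractf right_diff_distrib)

lemma matrix_mult_add_left: "(A + B) ** C = A ** C + B ** C"
  for A :: "'a::ring_1^'n^'m"
  by (vector matrix_matrix_mult_def sum.distrib distrib_right)

lemma bounded_bilinear_matrix_mult [bounded_bilinear]:
  "bounded_bilinear ((**) :: complex^'n^'m \<Rightarrow> complex^'p^'n \<Rightarrow> complex^'p^'m)"
  by (unfold_locales)
    (auto simp: matrix_mult_add_left matrix_add_ldistrib scalar_matrix_assoc matrix_scalar_ac
      intro!: exI[of _ 1] norm_matrix_mult_le)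

lemma matrix_vector_mult_scaleR_right: "M *v (c *\<^sub>R x) = c *\<^sub>R (M *v x)"
  for M :: "complex^'n^'m"
  by (simp add: scaleR_eq_smult vector_scalar_commute)

lemma scaleR_matrix_vector_mult: "(c *\<^sub>R M) *v x = c *\<^sub>R (M *v x)"
  for M :: "complex^'n^'m"
  by (simp add: vec_eq_iff matrix_vector_mult_def scaleR_sum_right)

lemma bounded_bilinear_matrix_vector_mult [bounded_bilinear]:
  "bounded_bilinear ((*v) :: complex^'n^'m \<Rightarrow> complex^'n \<Rightarrow> complex^'m)"
  by (unfold_locales)
    (auto simp: matrix_vector_right_distrib matrix_vector_mult_add_rdistrib
      matrix_vector_mult_scaleR_right scaleR_matrix_vector_mult
      intro!: exI[of _ 1] norm_matrix_vector_mult_le)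

lemma invertible_iff_ker: "invertible M \<longleftrightarrow> (\<forall>x. M *v x = 0 \<longrightarrow> x = 0)"
  for M :: "'a::field^'n^'n"
  by (simp add: invertible_left_inverse matrix_left_invertible_ker)

lemma
  fixes M :: "'a::field^'n^'n"
  assumes "invertible M"
  shows matrix_inv_right: "M ** matrix_inv M = mat 1"
    and matrix_inv_left: "matrix_inv M ** M = mat 1"
  using someI_ex[of "\<lambda>N. M ** N = mat 1 \<and> N ** M = mat 1"] assms
  unfolding invertible_def matrix_inv_def by auto

lemma matrix_inv_vector:
  fixes M :: "'a::field^'n^'n"
  assumes "invertible M"
  shows "M *v (matrix_inv M *v x) = x" "matrix_inv M *v (M *v x) = x"
  by (simp_all add: matrix_vector_mul_assoc matrix_inv_left matrix_inv_right assms)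

lemma matrix_inv_unique:
  fixes M :: "'a::field^'n^'n"
  assumes "M ** N = mat 1"
  shows "matrix_inv M = N"
proof -
  have "invertible M" using assms invertible_right_inverse by blast
  then have "N = matrix_inv M ** (M ** N)"
    by (simp add: matrix_mul_assoc matrix_inv_left)
  then show ?thesis using assms by simp
qed

lemma matrix_inv_commute:
  fixes M N :: "'a::field^'n^'n"
  assumes "invertible M" "M ** N = N ** M"
  shows "matrix_inv M ** N = N ** matrix_inv M"
proof -
  have "matrix_inv M ** N = matrix_inv M ** N ** (M ** matrix_inv M)"
    by (simp add: matrix_inv_right assms)
  also have "\<dots> = matrix_inv M ** (N ** M) ** matrix_inv M"
    by (simp only: matrix_mul_assoc)
  also have "\<dots> = matrix_inv M ** (M ** N) ** matrix_inv M"
    by (simp only: assms)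
  also have "\<dots> = N ** matrix_inv M"
    by (simp add: matrix_mul_assoc matrix_inv_left assms(1))
  finally show ?thesis .
qed

section \<open>Eigenvectors in invariant subspaces\<close>

text \<open>The vector \<open>p(B) w\<close>, computed by Horner's scheme from the leading
  coefficient down.\<close>

definition poly_vec :: "complex^'n^'n \<Rightarrow> complex^'n \<Rightarrow> complex poly \<Rightarrow> complex^'n" where
  "poly_vec B w p = fold_coeffs (\<lambda>a v. a *s w + B *v v) p 0"

lemma poly_vec_0 [simp]: "poly_vec B w 0 = 0"
  by (simp add: poly_vec_def)

lemma poly_vec_pCons [simp]: "poly_vec B w (pCons a p) = a *s w + B *v poly_vec B w p"
  by (cases "p = 0 \<and> a = 0") (auto simp: poly_vec_def fold_coeffs_pCons_coeff_not_0_eq fold_coeffs_pCons_not_0_0_eq)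

lemma poly_vec_add: "poly_vec B w (p + q) = poly_vec B w p + poly_vec B w q"
  by (induction p q rule: poly_induct2) (simp_all add: algebra_simps vector_sadd_rdistrib)

lemma poly_vec_smult: "poly_vec B w (smult c p) = c *s poly_vec B w p"
  by (induction p) (simp_all add: vector_add_ldistrib vector_smult_assoc vector_scalar_commute)

lemma poly_vec_mem:
  assumes "vec.subspace S" "\<And>x. x \<in> S \<Longrightarrow> B *v x \<in> S" "w \<in> S"
  shows "poly_vec B w p \<in> S"
  by (induction p) (use assms in \<open>auto simp: vec.subspace_0 vec.subspace_add vec.subspace_scale\<close>)

text \<open>In finite dimension the vectors \<open>B^k w\<close> cannot all be independent of their
  predecessors. A relation \<open>B^k w = p(B) w\<close> with \<open>p\<close> of degree below
  \<open>k\<close> yields the nonzero polynomial \<open>x^k - p\<close>.\<close>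

lemma exists_annihilating_poly:
  fixes B :: "complex^'n^'n"
  shows "\<exists>p. p \<noteq> 0 \<and> poly_vec B w p = 0"
proof -
  let ?b = "\<lambda>k. poly_vec B w (monom 1 k)"
  have "\<exists>k. ?b k \<in> vec.span (?b ` {..<k})"
  proof (rule ccontr)
    assume "\<not> ?thesis"
    then have n: "?b k \<notin> vec.span (?b ` {..<k})" for k by blast
    have "vec.dim (?b ` {..<k}) = k" for k
      by (induction k) (simp_all add: lessThan_Suc vec.dim_insert n)
    from this[of "Suc CARD('n)"] show False
      using vec.dim_subset_UNIV[of "?b ` {..<Suc CARD('n)}"] by (simp add: vec.dimension_def card_cart_basis del: lessThan_Suc)
  qed
  then obtain k where k: "?b k \<in> vec.span (?b ` {..<k})" by blast
  \<comment> \<open>Degree below \<open>k\<close> is expressed by vanishing coefficients, which for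
    \<open>k = 0\<close> leaves only the zero polynomial.\<close>
  let ?S = "{poly_vec B w p | p. \<forall>i\<ge>k. coeff p i = 0}"
  have "vec.span (?b ` {..<k}) \<subseteq> ?S"
  proof (rule vec.span_minimal)
    show "vec.subspace ?S"
    proof (rule vec.subspaceI)
      have "0 = poly_vec B w 0" by simp
      moreover have "\<forall>i\<ge>k. coeff (0 :: complex poly) i = 0" by simp
      ultimately show "0 \<in> ?S" by blast
    next
      fix x y c assume "x \<in> ?S" "y \<in> ?S"
      then obtain p q where "x = poly_vec B w p" "y = poly_vec B w q"
        and pq: "\<forall>i\<ge>k. coeff p i = 0" "\<forall>i\<ge>k. coeff q i = 0" by blast
      then have "x + y = poly_vec B w (p + q)" "c *s x = poly_vec B w (smult c p)"
        by (simp_all add: poly_vec_add poly_vec_smult)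
      moreover have "\<forall>i\<ge>k. coeff (p + q) i = 0" "\<forall>i\<ge>k. coeff (smult c p) i = 0"
        using pq by simp_all
      ultimately show "x + y \<in> ?S" "c *s x \<in> ?S" by blast+
    qed
    have "\<forall>i\<ge>k. coeff (monom (1 :: complex) j) i = 0" if "j < k" for j using that by simp
    then show "?b ` {..<k} \<subseteq> ?S" by blast
  qed
  with k obtain p where p: "?b k = poly_vec B w p" "coeff p k = 0" by force
  have "poly_vec B w (monom 1 k + smult (- 1) p) = 0"
    using p(1) by (simp add: poly_vec_add poly_vec_smult del: smult_minus_left)
  moreover have "coeff (monom 1 k + smult (- 1) p) k = 1" using p(2) by simp
  ultimately show ?thesis by (metis coeff_0 zero_neq_one)
qed

text \<open>Among the polynomials annihilating \<open>w\<close>, one of least degree has a root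
  \<open>r\<close>. Dividing off \<open>x - r\<close> leaves \<open>q\<close> with
  \<open>q(B) w\<close> nonzero by minimality; this vector is an eigenvector for \<open>r\<close>
  and stays in \<open>S\<close>. With \<open>S\<close> a kernel or eigenspace of a matrix commuting
  with \<open>B\<close>, this supplies the common eigenvectors that replace a diagonalisation
  below.\<close>

lemma exists_eigenvector:
  fixes B :: "complex^'n^'n"
  assumes S: "vec.subspace S" "\<And>x. x \<in> S \<Longrightarrow> B *v x \<in> S" and w: "w \<in> S" "w \<noteq> 0"
  obtains u b where "u \<in> S" "u \<noteq> 0" "B *v u = b *s u"
proof -
  obtain p where p: "p \<noteq> 0" "poly_vec B w p = 0"
    and min: "\<And>q. q \<noteq> 0 \<Longrightarrow> poly_vec B w q = 0 \<Longrightarrow> degree p \<le> degree q"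
    using ex_has_least_nat[of "\<lambda>p. p \<noteq> 0 \<and> poly_vec B w p = 0" _ degree]
      exists_annihilating_poly[of B w] by metis
  have "degree p \<noteq> 0"
  proof
    assume "degree p = 0"
    then obtain a where "p = [:a:]" by (rule degree_eq_zeroE)
    with p w show False by simp
  qed
  then have "\<not> constant (poly p)" by (simp add: constant_degree)
  then obtain r where "poly p r = 0" using fundamental_theorem_of_algebra by blast
  then obtain q where q: "p = [:- r, 1:] * q" by (auto simp: poly_eq_0_iff_dvd elim!: dvdE)
  then have "q \<noteq> 0" "degree p = Suc (degree q)" using p(1) by (auto simp: degree_mult_eq simp del: mult_pCons_left)
  then have "poly_vec B w q \<noteq> 0" using min[of q] by auto
  moreover have "p = smult (- r) q + pCons 0 q" using q by simp
  then have "B *v poly_vec B w q = r *s poly_vec B w q"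
    using p(2) by (simp add: poly_vec_add poly_vec_smult del: smult_minus_left)
  moreover have "poly_vec B w q \<in> S" by (rule poly_vec_mem) (use S w in auto)
  ultimately show ?thesis using that by blast
qed

section \<open>The matrix exponential\<close>

lemma mat_pow_0 [simp]: "mat_pow A 0 = mat 1"
  and mat_pow_Suc [simp]: "mat_pow A (Suc k) = A ** mat_pow A k"
  by (simp_all add: mat_pow_def)

lemma norm_mat_pow_le: "norm (mat_pow A k) \<le> norm (mat 1 :: complex^'n^'n) * norm A ^ k"
  for A :: "complex^'n^'n"
proof (induction k)
  case (Suc k)
  have "norm (mat_pow A (Suc k)) \<le> norm A * norm (mat_pow A k)"
    by (simp add: norm_matrix_mult_le)
  also have "\<dots> \<le> norm A * (norm (mat 1 :: complex^'n^'n) * norm A ^ k)"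
    by (intro mult_left_mono Suc) simp
  finally show ?case by (simp add: algebra_simps)
qed simp

lemma summable_mat_exp: "summable (\<lambda>k. mat_pow A k /\<^sub>R fact k)" for A :: "complex^'n^'n"
proof (rule summable_norm_cancel, rule summable_comparison_test)
  show "summable (\<lambda>k. norm (mat 1 :: complex^'n^'n) * (inverse (fact k) * norm A ^ k))"
    by (intro summable_mult summable_exp)
  show "\<exists>N. \<forall>k\<ge>N. norm (norm (mat_pow A k /\<^sub>R fact k))
      \<le> norm (mat 1 :: complex^'n^'n) * (inverse (fact k) * norm A ^ k)"
    using norm_mat_pow_le[of A] by (auto simp: field_simps)
qed

lemma mat_exp_0 [simp]: "mat_exp (0 :: complex^'n^'n) = mat 1"
proof -
  have "mat_pow (0 :: complex^'n^'n) k = 0" if "k \<noteq> 0" for k using that by (cases k) auto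
  then have "mat_exp (0 :: complex^'n^'n) = (\<Sum>k\<in>{0}. mat_pow 0 k /\<^sub>R fact k)"
    unfolding mat_exp_def by (intro suminf_finite) auto
  then show ?thesis by simp
qed

lemma matrix_commute_mat_pow:
  "B ** A = A ** B \<Longrightarrow> B ** mat_pow A k = mat_pow A k ** B"
  by (induction k) (simp_all, metis matrix_mul_assoc)

lemma matrix_commute_mat_exp:
  assumes "B ** A = A ** B"
  shows "B ** mat_exp A = mat_exp A ** (B :: complex^'n^'n)"
proof -
  note bl = bounded_bilinear.bounded_linear_left[OF bounded_bilinear_matrix_mult, of B]
    bounded_bilinear.bounded_linear_right[OF bounded_bilinear_matrix_mult, of B]
  show ?thesis
    unfolding mat_exp_def bl[THEN bounded_linear.suminf, OF summable_mat_exp]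
    by (simp add: matrix_scalar_ac matrix_commute_mat_pow assms flip: scalar_matrix_assoc)
qed

lemma mat_pow_eigenvector: "A *v u = a *s u \<Longrightarrow> mat_pow A k *v u = a ^ k *s u"
  for A :: "complex^'n^'n"
  by (induction k) (simp_all add: vector_scalar_commute vector_smult_assoc mult.commute
      flip: matrix_vector_mul_assoc)

lemma scaleR_smult_left: "(r *\<^sub>R c) *s u = r *\<^sub>R (c *s u)" for u :: "complex^'n"
  by (simp add: vec_eq_iff)

lemma bounded_linear_smult_left: "bounded_linear (\<lambda>c. c *s u)" for u :: "complex^'n"
  by (rule bounded_linear_intro[of _ "norm u"])
    (simp_all add: vector_sadd_rdistrib scaleR_smult_left norm_vector_smult)

lemma mat_exp_eigenvector:
  fixes A :: "complex^'n^'n"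
  assumes "A *v u = a *s u"
  shows "mat_exp A *v u = exp a *s u"
proof -
  have "mat_exp A *v u = (\<Sum>k. (mat_pow A k /\<^sub>R fact k) *v u)"
    unfolding mat_exp_def
    by (rule bounded_linear.suminf[OF bounded_bilinear.bounded_linear_left
          [OF bounded_bilinear_matrix_vector_mult] summable_mat_exp])
  also have "\<dots> = (\<Sum>k. (a ^ k /\<^sub>R fact k) *s u)"
    by (simp add: scaleR_matrix_vector_mult mat_pow_eigenvector[OF assms] scaleR_smult_left)
  also have "\<dots> = (\<Sum>k. a ^ k /\<^sub>R fact k) *s u"
    by (rule bounded_linear.suminf[OF bounded_linear_smult_left, symmetric]) (rule summable_exp_generic)
  finally show ?thesis by (simp add: exp_def)
qed

lemma mat_pow_scaleR: "mat_pow (r *\<^sub>R A) k = r ^ k *\<^sub>R mat_pow A k" for A :: "complex^'n^'n"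
  by (induction k) (simp_all add: matrix_scalar_ac flip: scalar_matrix_assoc)

lemma bounded_linear_matrix_nth: "bounded_linear (\<lambda>M. M $ i $ j)"
  by (rule bounded_linear_compose[OF bounded_linear_vec_nth bounded_linear_vec_nth])

text \<open>Each entry of \<open>exp (s Y)\<close> is an everywhere convergent power series in
  \<open>s\<close>, so scalar termwise differentiation applies, and the matrix derivative is
  assembled from its components.\<close>

lemma has_vector_derivative_mat_exp:
  fixes Y :: "complex^'n^'n"
  shows "((\<lambda>s. mat_exp (s *\<^sub>R Y)) has_vector_derivative Y ** mat_exp (s *\<^sub>R Y)) (at s)"
proof -
  have comp: "((\<lambda>s. mat_exp (s *\<^sub>R Y) $ i $ j) has_vector_derivative
      (Y ** mat_exp (s *\<^sub>R Y)) $ i $ j) (at s)" for i j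
  proof -
    define c where "c k = mat_pow Y k $ i $ j / fact k" for k
    have eq: "mat_exp (r *\<^sub>R Y) $ i $ j = (\<Sum>k. c k * of_real r ^ k)" for r
      unfolding mat_exp_def bounded_linear.suminf[OF bounded_linear_matrix_nth summable_mat_exp]
      by (simp add: mat_pow_scaleR c_def scaleR_conv_of_real[where 'a = complex] field_simps)
    have "Y ** mat_exp (r *\<^sub>R Y) = (\<Sum>k. Y ** (mat_pow (r *\<^sub>R Y) k /\<^sub>R fact k))" for r
      unfolding mat_exp_def
      by (rule bounded_linear.suminf[OF bounded_bilinear.bounded_linear_right
            [OF bounded_bilinear_matrix_mult] summable_mat_exp])
    moreover have "summable (\<lambda>k. Y ** (mat_pow (r *\<^sub>R Y) k /\<^sub>R fact k))" for r
      by (rule bounded_linear.summable[OF bounded_bilinear.bounded_linear_right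
            [OF bounded_bilinear_matrix_mult] summable_mat_exp])
    \<comment> \<open>\<open>diffs c k\<close> is \<open>(k + 1) c (k + 1)\<close>: the factor
      cancels against the factorial and leaves one additional \<open>Y\<close> on the left.\<close>
    ultimately have eq': "(Y ** mat_exp (r *\<^sub>R Y)) $ i $ j = (\<Sum>k. diffs c k * of_real r ^ k)" for r
      by (simp add: bounded_linear.suminf[OF bounded_linear_matrix_nth]
          mat_pow_scaleR c_def diffs_def scaleR_conv_of_real[where 'a = complex] matrix_scalar_ac field_simps
          del: of_nat_Suc flip: scalar_matrix_assoc)
    have "summable (\<lambda>k. c k * z ^ k)" for z
    proof (rule summable_norm_cancel, rule summable_comparison_test)
      show "summable (\<lambda>k. norm (mat 1 :: complex^'n^'n) * (inverse (fact k) * (norm Y * norm z) ^ k))"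
        by (intro summable_mult summable_exp)
      have "norm (mat_pow Y k $ i $ j) * norm z ^ k
          \<le> norm (mat 1 :: complex^'n^'n) * (norm Y * norm z) ^ k" for k
      proof -
        have "norm (mat_pow Y k $ i $ j) \<le> norm (mat_pow Y k)"
          by (meson Finite_Cartesian_Product.norm_nth_le order_trans)
        also note norm_mat_pow_le
        finally show ?thesis
          by (simp add: power_mult_distrib mult_right_mono flip: mult.assoc)
      qed
      then show "\<exists>N. \<forall>k\<ge>N. norm (norm (c k * z ^ k))
          \<le> norm (mat 1 :: complex^'n^'n) * (inverse (fact k) * (norm Y * norm z) ^ k)"
        by (auto simp: c_def norm_mult norm_divide norm_power divide_simps)
    qed
    from termdiffs_strong_converges_everywhere[OF this]
    have "((\<lambda>x. \<Sum>k. c k * x ^ k) has_field_derivative (\<Sum>k. diffs c k * of_real s ^ k)) (at (of_real s))" .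
    then show ?thesis unfolding eq eq' by (rule has_vector_derivative_real_field)
  qed
  show ?thesis
    unfolding has_vector_derivative_def
  proof (subst has_derivative_componentwise_within, rule ballI)
    fix b :: "complex^'n^'n" assume "b \<in> Basis"
    then obtain i j c where b: "b = axis i (axis j c)" by (auto simp: Basis_vec_def)
    show "((\<lambda>x. mat_exp (x *\<^sub>R Y) \<bullet> b) has_derivative
        (\<lambda>x. (x *\<^sub>R (Y ** mat_exp (s *\<^sub>R Y))) \<bullet> b)) (at s)"
      using has_derivative_inner_left[OF comp[of i j, unfolded has_vector_derivative_def], of c]
      by (simp add: b inner_axis)
  qed
qed

section \<open>The integral representation of the logarithm\<close>

lemma matrix_vector_mult_axis: "M *v axis j 1 = column j M" for M :: "complex^'n^'m"
  by (simp add: matrix_vector_mult_def column_def axis_def vec_eq_iff if_distrib cong: if_cong)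

text \<open>Entries are bounded through the columns \<open>M e_j\<close>. The crude dimension
  factors turn operator bounds into Frobenius bounds for limit arguments; the constants of the final
  estimate do not depend on them.\<close>

lemma norm_matrix_le:
  fixes M :: "complex^'n^'m" and b :: real
  assumes "\<And>x. norm (M *v x) \<le> b * norm x"
  shows "norm M \<le> CARD('m) * (CARD('n) * b)"
proof -
  have "norm (M $ i $ j) \<le> b" for i j
  proof -
    have "norm (axis j 1 :: complex^'n) = 1"
      by (rule norm_Basis) (simp add: Basis_complex_def)
    then have "norm (column j M) \<le> b"
      using assms[of "axis j 1"] by (simp add: matrix_vector_mult_axis)
    then show ?thesis
      using Finite_Cartesian_Product.norm_nth_le[of "column j M" i] by (simp add: column_def)
  qed
  moreover have "norm M \<le> (\<Sum>i\<in>UNIV. norm (M $ i))"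
    unfolding norm_vec_def[of M] by (rule L2_set_le_sum) simp
  moreover have "norm (M $ i) \<le> (\<Sum>j\<in>UNIV. norm (M $ i $ j))" for i
    unfolding norm_vec_def[of "M $ i"] by (rule L2_set_le_sum) simp
  ultimately have "norm M \<le> (\<Sum>i\<in>(UNIV :: 'm set). \<Sum>j\<in>(UNIV :: 'n set). b)"
    by (meson order_trans sum_mono)
  then show ?thesis by simp
qed

text \<open>The resolvent identity, behind all perturbation arguments below: expanding the right
  side cancels one inverse in each term.\<close>

lemma matrix_inv_diff:
  fixes P Q :: "'a::field^'n^'n"
  assumes "invertible P" "invertible Q"
  shows "matrix_inv Q - matrix_inv P = matrix_inv P ** (P - Q) ** matrix_inv Q"
  using assms
  by (simp add: matrix_mult_minus_left matrix_mult_minus_right matrix_inv_left matrix_inv_right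
      flip: matrix_mul_assoc)

text \<open>Quantitative injectivity: for \<open>c > 0\<close> it gives invertibility with operator
  bound \<open>1 / c\<close> for the inverse, and it survives perturbations smaller than
  \<open>c\<close>.\<close>

definition bounded_below :: "real \<Rightarrow> complex^'n^'n \<Rightarrow> bool" where
  "bounded_below c M \<longleftrightarrow> (\<forall>x. c * norm x \<le> norm (M *v x))"

lemma bounded_below_invertible: "bounded_below c M \<Longrightarrow> c > 0 \<Longrightarrow> invertible M"
  unfolding invertible_iff_ker
proof (intro allI impI)
  fix x assume "bounded_below c M" "c > 0" "M *v x = 0"
  then have "c * norm x \<le> 0" unfolding bounded_below_def by (metis norm_zero)
  then show "x = 0" using \<open>c > 0\<close> by (simp add: mult_le_0_iff)
qed

lemma norm_matrix_inv_vector_le: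
  assumes "bounded_below c M" "c > 0"
  shows "norm (matrix_inv M *v x) \<le> norm x / c"
proof -
  have "c * norm (matrix_inv M *v x) \<le> norm (M *v (matrix_inv M *v x))"
    using assms(1) bounded_below_def by blast
  then show ?thesis
    using assms by (simp add: matrix_inv_vector bounded_below_invertible field_simps)
qed

lemma norm_matrix_inv_le:
  fixes M :: "complex^'n^'n"
  assumes "bounded_below c M" "c > 0"
  shows "norm (matrix_inv M) \<le> CARD('n) * (CARD('n) * (1 / c))"
  by (rule norm_matrix_le[of "matrix_inv M" "1 / c"]) (use norm_matrix_inv_vector_le[OF assms] in simp)

text \<open>The common \<open>c\<close> bounds all inverses uniformly, so the resolvent identity
  bounds their difference by a constant times \<open>norm (f t - f s)\<close>.\<close>

lemma continuous_on_matrix_inv: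
  fixes f :: "real \<Rightarrow> complex^'n^'n"
  assumes f: "continuous_on S f" and c: "\<And>t. t \<in> S \<Longrightarrow> bounded_below c (f t)" "c > 0"
  shows "continuous_on S (\<lambda>t. matrix_inv (f t))"
  unfolding continuous_on_def
proof
  fix t assume t: "t \<in> S"
  define K where "K = CARD('n) * (CARD('n) * (1 / c))"
  have K: "norm (matrix_inv (f s)) \<le> K" if "s \<in> S" for s
    unfolding K_def using norm_matrix_inv_le[OF c(1)[OF that] c(2)] .
  have "K \<ge> 0" using c(2) by (simp add: K_def)
  have "norm (matrix_inv (f s) - matrix_inv (f t)) \<le> K * norm (f t - f s) * K" if "s \<in> S" for s
  proof -
    have "matrix_inv (f s) - matrix_inv (f t) = matrix_inv (f t) ** (f t - f s) ** matrix_inv (f s)"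
      using bounded_below_invertible[OF c(1) c(2)] t that by (intro matrix_inv_diff)
    then have "norm (matrix_inv (f s) - matrix_inv (f t))
        \<le> norm (matrix_inv (f t)) * norm (f t - f s) * norm (matrix_inv (f s))"
      using order_trans[OF norm_matrix_mult_le mult_right_mono[OF norm_matrix_mult_le norm_ge_zero]]
      by metis
    also have "\<dots> \<le> K * norm (f t - f s) * K"
      using K[OF t] K[OF that] \<open>K \<ge> 0\<close> by (intro mult_mono) auto
    finally show ?thesis .
  qed
  then have "\<forall>\<^sub>F s in at t within S.
      norm (matrix_inv (f s) - matrix_inv (f t)) \<le> K * norm (f t - f s) * K"
    by (auto simp: eventually_at_filter intro!: always_eventually)
  moreover have "(f \<longlongrightarrow> f t) (at t within S)"
    using f t unfolding continuous_on_def by blast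
  then have "((\<lambda>s. K * norm (f t - f s) * K) \<longlongrightarrow> K * norm (f t - f t) * K) (at t within S)"
    by (rule tendsto_mult[OF tendsto_mult[OF tendsto_const
          tendsto_norm[OF tendsto_diff[OF tendsto_const]]] tendsto_const])
  ultimately have "((\<lambda>s. matrix_inv (f s) - matrix_inv (f t)) \<longlongrightarrow> 0) (at t within S)"
    using Lim_null_comparison[of "\<lambda>s. matrix_inv (f s) - matrix_inv (f t)" "\<lambda>s. K * norm (f t - f s) * K"]
    by simp
  then show "((\<lambda>s. matrix_inv (f s)) \<longlongrightarrow> matrix_inv (f t)) (at t within S)"
    by (simp add: LIM_zero_iff)
qed

section \<open>The resolvent along the segment from the identity\<close>

definition segment_to_id :: "real \<Rightarrow> complex^'n^'n \<Rightarrow> complex^'n^'n" where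
  "segment_to_id t B = t *\<^sub>R (B - mat 1) + mat 1"

definition resolvent :: "real \<Rightarrow> complex^'n^'n \<Rightarrow> complex^'n^'n" where
  "resolvent t B = matrix_inv (segment_to_id t B)"

text \<open>An eigenvalue \<beta> makes the segment singular where
  \<open>t (\<beta> - 1) = -1\<close>, which happens for some \<open>t\<close> in
  \<open>[0,1]\<close> exactly if \<beta> is real and at most zero. This is therefore the usual
  domain of the principal logarithm, in the form that the integrals use.\<close>

definition log_domain :: "(complex^'n^'n) set" where
  "log_domain = {B. \<forall>t\<in>{0..1}. invertible (segment_to_id t B)}"

definition log_integral :: "complex^'n^'n \<Rightarrow> complex^'n^'n" where
  "log_integral B = integral {0..1} (\<lambda>t. (B - mat 1) ** resolvent t B)"

lemma continuous_on_segment_to_id: "continuous_on S (\<lambda>t. segment_to_id t B)"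
  unfolding segment_to_id_def by (intro continuous_intros)

text \<open>On the compact product of \<open>[0,1]\<close> and the unit sphere, the norm of
  \<open>segment_to_id t B *v x\<close> attains a minimum, positive by invertibility; homogeneity
  extends the bound to all vectors.\<close>

lemma log_domain_bounded_below:
  fixes B :: "complex^'n^'n"
  assumes "B \<in> log_domain"
  obtains c where "c > 0" "\<And>t. t \<in> {0..1} \<Longrightarrow> bounded_below c (segment_to_id t B)"
proof -
  let ?K = "{0..1::real} \<times> sphere (0 :: complex^'n) 1"
  let ?g = "\<lambda>p. norm (segment_to_id (fst p) B *v snd p)"
  obtain e :: "complex^'n" where e: "norm e = 1" using vector_choose_size[of 1] by auto
  have "continuous_on ?K ?g"
    unfolding segment_to_id_def by (intro continuous_intros)
  moreover have "compact ?K" by (intro compact_Times) auto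
  moreover have "(0, e) \<in> ?K" using e by auto
  ultimately obtain p where p: "p \<in> ?K" "\<And>q. q \<in> ?K \<Longrightarrow> ?g p \<le> ?g q"
    using continuous_attains_inf[of ?K ?g] by blast
  show ?thesis
  proof
    have "snd p \<noteq> 0" using p(1) by auto
    then show "?g p > 0"
      using assms p(1) by (auto simp: log_domain_def invertible_iff_ker)
    show "bounded_below (?g p) (segment_to_id t B)" if t: "t \<in> {0..1}" for t
      unfolding bounded_below_def
    proof
      fix x
      show "?g p * norm x \<le> norm (segment_to_id t B *v x)"
      proof (cases "x = 0")
        case False
        have "?g p \<le> norm (segment_to_id t B *v sgn x)"
          using p(2)[of "(t, sgn x)"] t False by (simp add: norm_sgn)
        then show ?thesis using False
          by (simp add: sgn_div_norm matrix_vector_mult_scaleR_right field_simps)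
      qed simp
    qed
  qed
qed

lemma bounded_below_segment_to_id_perturb:
  assumes "bounded_below c (segment_to_id t B)" "t \<in> {0..1}" "norm (B' - B) \<le> d"
  shows "bounded_below (c - d) (segment_to_id t B')"
  unfolding bounded_below_def
proof
  fix x
  have "segment_to_id t B *v x - segment_to_id t B' *v x = t *\<^sub>R ((B - B') *v x)"
    by (simp add: segment_to_id_def algebra_simps scaleR_matrix_vector_mult)
  then have "norm (segment_to_id t B *v x - segment_to_id t B' *v x) \<le> 1 * norm ((B - B') *v x)"
    using assms(2) by (simp add: mult_right_mono mult_left_le_one_le)
  also have "\<dots> \<le> norm (B - B') * norm x" by (simp add: norm_matrix_vector_mult_le)
  also have "\<dots> \<le> d * norm x" using assms(3) by (intro mult_right_mono) (auto simp: norm_minus_commute)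
  finally have "norm (segment_to_id t B *v x) - norm (segment_to_id t B' *v x) \<le> d * norm x"
    using norm_triangle_ineq2 order_trans by blast
  moreover have "c * norm x \<le> norm (segment_to_id t B *v x)" using assms(1) bounded_below_def by blast
  ultimately show "(c - d) * norm x \<le> norm (segment_to_id t B' *v x)"
    by (simp add: algebra_simps)
qed

text \<open>Half of the lower bound at \<open>B\<close> is spent on the perturbation, so that one
  constant serves both as radius and as uniform lower bound. In particular \<open>log_domain\<close>
  is open.\<close>

lemma log_domain_nhd:
  assumes "B \<in> log_domain"
  obtains c where "c > 0" "\<And>t B'. t \<in> {0..1} \<Longrightarrow> norm (B' - B) \<le> c \<Longrightarrow> bounded_below c (segment_to_id t B')"
proof -
  obtain c where c: "c > 0" "\<And>t. t \<in> {0..1} \<Longrightarrow> bounded_below c (segment_to_id t B)"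
    using log_domain_bounded_below[OF assms] by blast
  show ?thesis
    by (rule that[of "c / 2"])
      (use c(1) bounded_below_segment_to_id_perturb[OF c(2), of _ _ "c / 2"] in auto)
qed

lemma log_domainI: "(\<And>t. t \<in> {0..1} \<Longrightarrow> bounded_below c (segment_to_id t B)) \<Longrightarrow> c > 0 \<Longrightarrow> B \<in> log_domain"
  unfolding log_domain_def by (blast intro: bounded_below_invertible)

lemma continuous_on_resolvent:
  assumes "B \<in> log_domain"
  shows "continuous_on {0..1} (\<lambda>t. resolvent t B)"
proof -
  obtain c where c: "c > 0" "\<And>t. t \<in> {0..1} \<Longrightarrow> bounded_below c (segment_to_id t B)"
    using log_domain_bounded_below[OF assms] by blast
  show ?thesis unfolding resolvent_def
    by (rule continuous_on_matrix_inv[OF continuous_on_segment_to_id c(2) c(1)])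
qed

lemma segment_to_id_commute:
  "B ** N = N ** B \<Longrightarrow> segment_to_id t B ** N = N ** segment_to_id t B"
  by (simp add: segment_to_id_def matrix_mult_add_left matrix_add_ldistrib
      matrix_mult_minus_left matrix_mult_minus_right matrix_scalar_ac scaleR_right_diff_distrib
      flip: scalar_matrix_assoc)

lemma resolvent_commute:
  assumes "B \<in> log_domain" "t \<in> {0..1}" "B ** N = N ** B"
  shows "resolvent t B ** N = N ** resolvent t B"
  unfolding resolvent_def
  using assms by (intro matrix_inv_commute segment_to_id_commute) (auto simp: log_domain_def)

lemma resolvent_diff:
  assumes "B \<in> log_domain" "B' \<in> log_domain" "t \<in> {0..1}"
  shows "resolvent t B' - resolvent t B = resolvent t B ** (t *\<^sub>R (B - B')) ** resolvent t B'"
proof -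
  have "segment_to_id t B - segment_to_id t B' = t *\<^sub>R (B - B')"
    by (simp add: segment_to_id_def algebra_simps)
  then show ?thesis
    using assms by (simp add: resolvent_def matrix_inv_diff log_domain_def)
qed

text \<open>Since \<open>B - I\<close> commutes with the resolvent of \<open>B\<close>, one
  resolvent can be pulled out on each side. In the remaining middle factor the terms
  \<open>t (B - I) (B' - I)\<close> cancel and leave \<open>B' - B\<close>.\<close>

lemma log_integrand_diff:
  assumes "B \<in> log_domain" "B' \<in> log_domain" "t \<in> {0..1}"
  shows "(B' - mat 1) ** resolvent t B' - (B - mat 1) ** resolvent t B
    = resolvent t B ** (B' - B) ** resolvent t B'"
proof -
  let ?P = "segment_to_id t B" and ?P' = "segment_to_id t B'"
  let ?R = "resolvent t B" and ?R' = "resolvent t B'"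
  have inv: "?R ** ?P = mat 1" "?P' ** ?R' = mat 1"
    using assms by (auto simp: resolvent_def log_domain_def matrix_inv_left matrix_inv_right)
  have "(B - mat 1) ** ?R = ?R ** (B - mat 1)"
    by (rule resolvent_commute[symmetric])
      (use assms in \<open>auto simp: matrix_mult_minus_left matrix_mult_minus_right\<close>)
  then have "(B' - mat 1) ** ?R' - (B - mat 1) ** ?R
      = ?R ** ?P ** (B' - mat 1) ** ?R' - ?R ** (B - mat 1) ** (?P' ** ?R')"
    using inv by simp
  also have "\<dots> = ?R ** (?P ** (B' - mat 1) - (B - mat 1) ** ?P') ** ?R'"
    by (simp add: matrix_mult_minus_left[of _ _ ?R'] matrix_mult_minus_right[of ?R] matrix_mul_assoc)
  also have "?P ** (B' - mat 1) - (B - mat 1) ** ?P' = B' - B"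
    by (simp add: segment_to_id_def matrix_mult_add_left matrix_add_ldistrib
        matrix_scalar_ac flip: scalar_matrix_assoc)
  finally show ?thesis .
qed

lemma integrable_sandwich:
  assumes "B \<in> log_domain" "B' \<in> log_domain"
  shows "(\<lambda>t. resolvent t B ** E ** resolvent t B') integrable_on {0..1}"
  by (intro integrable_continuous_interval continuous_intros continuous_on_resolvent assms)

lemma integrable_log_integrand:
  assumes "B \<in> log_domain"
  shows "(\<lambda>t. (B - mat 1) ** resolvent t B) integrable_on {0..1}"
  by (intro integrable_continuous_interval continuous_intros continuous_on_resolvent assms)

lemma log_integral_diff:
  assumes "B \<in> log_domain" "B' \<in> log_domain"
  shows "log_integral B' - log_integral B
    = integral {0..1} (\<lambda>t. resolvent t B ** (B' - B) ** resolvent t B')"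
  unfolding log_integral_def
  by (simp add: integrable_log_integrand assms flip: integral_diff)
    (intro integral_cong log_integrand_diff assms)

section \<open>The derivative of the logarithm integral\<close>

definition log_deriv :: "complex^'n^'n \<Rightarrow> complex^'n^'n \<Rightarrow> complex^'n^'n" where
  "log_deriv B E = integral {0..1} (\<lambda>t. resolvent t B ** E ** resolvent t B)"

lemma bounded_linear_log_deriv:
  assumes "B \<in> log_domain"
  shows "bounded_linear (log_deriv B)"
  unfolding linear_conv_bounded_linear[symmetric] log_deriv_def
proof (rule linearI)
  note int = integrable_sandwich[OF assms assms]
  show "integral {0..1} (\<lambda>t. resolvent t B ** (E + F) ** resolvent t B)
    = integral {0..1} (\<lambda>t. resolvent t B ** E ** resolvent t B)
    + integral {0..1} (\<lambda>t. resolvent t B ** F ** resolvent t B)" for E F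
    by (simp add: matrix_add_ldistrib matrix_mult_add_left integral_add int)
  show "integral {0..1} (\<lambda>t. resolvent t B ** (r *\<^sub>R E) ** resolvent t B)
    = r *\<^sub>R integral {0..1} (\<lambda>t. resolvent t B ** E ** resolvent t B)" for r E
    by (simp add: matrix_scalar_ac integral_cmul int flip: scalar_matrix_assoc)
qed

text \<open>By the difference formula the remainder is the integral of \<open>R E (R' - R)\<close>,
  where \<open>R\<close> and \<open>R'\<close> are the resolvents of \<open>B\<close> and
  \<open>B'\<close>. The resolvent identity makes this quadratic in \<open>E\<close>, with the bound
  \<open>K^3 (norm E)^2\<close> uniform in \<open>t\<close>.\<close>

lemma has_derivative_log_integral:
  fixes B :: "complex^'n^'n"
  assumes B: "B \<in> log_domain"
  shows "(log_integral has_derivative log_deriv B) (at B)"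
proof -
  obtain c where c: "c > 0" "\<And>t B'. t \<in> {0..1} \<Longrightarrow> norm (B' - B) \<le> c \<Longrightarrow> bounded_below c (segment_to_id t B')"
    using log_domain_nhd[OF B] by blast
  define K where "K = CARD('n) * (CARD('n) * (1 / c))"
  have K: "norm (resolvent t B') \<le> K" if "t \<in> {0..1}" "norm (B' - B) \<le> c" for t B'
    unfolding K_def resolvent_def using norm_matrix_inv_le[OF c(2)[OF that] c(1)] .
  have "K \<ge> 0" using c(1) by (simp add: K_def)
  have dom: "B' \<in> log_domain" if "norm (B' - B) \<le> c" for B'
    using log_domainI[OF c(2)[OF _ that] c(1)] .
  have est: "norm (log_integral B' - log_integral B - log_deriv B (B' - B)) / norm (B' - B)
      \<le> K ^ 3 * norm (B' - B)" if B': "norm (B' - B) \<le> c" "B' \<noteq> B" for B'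
  proof -
    let ?E = "B' - B"
    have "log_integral B' - log_integral B - log_deriv B ?E
      = integral {0..1} (\<lambda>t. resolvent t B ** ?E ** resolvent t B' - resolvent t B ** ?E ** resolvent t B)"
      unfolding log_integral_diff[OF B dom[OF B'(1)]] log_deriv_def
      by (intro integral_diff[symmetric] integrable_sandwich B dom B')
    also have "norm \<dots> \<le> integral {0..1::real} (\<lambda>t. K ^ 3 * (norm ?E * norm ?E))"
    proof (rule integral_norm_bound_integral)
      show "(\<lambda>t. resolvent t B ** ?E ** resolvent t B' - resolvent t B ** ?E ** resolvent t B) integrable_on {0..1}"
        by (intro integrable_diff integrable_sandwich B dom B')
      fix t :: real assume t: "t \<in> {0..1}"
      have "resolvent t B ** ?E ** resolvent t B' - resolvent t B ** ?E ** resolvent t B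
        = resolvent t B ** ?E ** (resolvent t B ** (t *\<^sub>R (B - B')) ** resolvent t B')"
        by (simp only: matrix_mult_minus_right[symmetric] resolvent_diff[OF B dom[OF B'(1)] t])
      also have "norm \<dots> \<le> (norm (resolvent t B) * norm ?E) * ((norm (resolvent t B) * norm (t *\<^sub>R (B - B'))) * norm (resolvent t B'))"
        by (intro order_trans[OF norm_matrix_mult_le] mult_mono norm_matrix_mult_le order_refl) auto
      also have "\<dots> \<le> (K * norm ?E) * ((K * norm ?E) * K)"
        using K[OF t, of B] K[OF t B'(1)] c(1) \<open>K \<ge> 0\<close> t
        by (intro mult_mono) (auto simp: norm_minus_commute intro!: mult_left_le_one_le mult_nonneg_nonneg)
      finally show "norm (resolvent t B ** ?E ** resolvent t B' - resolvent t B ** ?E ** resolvent t B)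
          \<le> K ^ 3 * (norm ?E * norm ?E)"
        by (simp add: power3_eq_cube algebra_simps)
    qed auto
    finally show ?thesis using B'(2) by (simp add: divide_simps)
  qed
  show ?thesis
  proof (rule has_derivativeI_sandwich[where e = c and H = "\<lambda>B'. K ^ 3 * norm (B' - B)"])
    show "bounded_linear (log_deriv B)" by (rule bounded_linear_log_deriv[OF B])
    have "((\<lambda>B'. K ^ 3 * norm (B' - B)) \<longlongrightarrow> K ^ 3 * norm (B - B)) (at B)"
      by (intro tendsto_mult tendsto_const tendsto_norm tendsto_diff tendsto_ident_at)
    then show "((\<lambda>B'. K ^ 3 * norm (B' - B)) \<longlongrightarrow> 0) (at B)" by simp
    show "norm (log_integral B' - log_integral B - log_deriv B (B' - B)) / norm (B' - B)
        \<le> K ^ 3 * norm (B' - B)" if "B' \<noteq> B" "dist B' B < c" for B'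
      using est[of B'] that by (simp add: dist_norm)
  qed (use c(1) in auto)
qed

lemma integral_matrix_mult_left:
  fixes f :: "real \<Rightarrow> complex^'p^'n" and C :: "complex^'n^'m"
  assumes "f integrable_on S"
  shows "integral S (\<lambda>t. C ** f t) = C ** integral S f"
  using integral_linear[OF assms bounded_bilinear.bounded_linear_right
      [OF bounded_bilinear_matrix_mult, of C]]
  by (simp add: o_def)

lemma integral_matrix_mult_right:
  fixes f :: "real \<Rightarrow> complex^'n^'m" and C :: "complex^'p^'n"
  assumes "f integrable_on S"
  shows "integral S (\<lambda>t. f t ** C) = integral S f ** C"
  using integral_linear[OF assms bounded_bilinear.bounded_linear_left
      [OF bounded_bilinear_matrix_mult, of C]]
  by (simp add: o_def)

lemma integral_matrix_vector_mult:
  fixes f :: "real \<Rightarrow> complex^'n^'m"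
  assumes "f integrable_on S"
  shows "integral S f *v x = integral S (\<lambda>t. f t *v x)"
  using integral_linear[OF assms bounded_bilinear.bounded_linear_left
      [OF bounded_bilinear_matrix_vector_mult, of x]]
  by (simp add: o_def)

section \<open>The logarithm integral of an exponential\<close>

lemma segment_to_id_eigenvector:
  assumes "B *v u = \<beta> *s u"
  shows "segment_to_id t B *v u = (of_real t * (\<beta> - 1) + 1) *s u"
  using assms
  by (simp add: segment_to_id_def matrix_vector_mult_add_rdistrib scaleR_matrix_vector_mult
      matrix_vector_mult_diff_rdistrib scaleR_eq_smult vector_smult_assoc
      vector_sadd_rdistrib vector_ssub_ldistrib vector_sub_rdistrib right_diff_distrib)

text \<open>A nontrivial kernel of the segment matrix is invariant under \<open>Y\<close>, hence
  contains an eigenvector of \<open>Y\<close> with eigenvalue \<mu> in the strip. Then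
  \<open>t (exp (s \<mu>) - 1) + 1 = 0\<close> makes \<open>exp (s \<mu>)\<close> real. As the
  imaginary part of \<open>s \<mu>\<close> has modulus below \<open>pi\<close>, this real value is
  positive, and the equation fails.\<close>

lemma mat_exp_scaleR_in_log_domain:
  fixes Y :: "complex^'n^'n"
  assumes strip: "\<And>\<mu>. \<mu> \<in> eigenvalues Y \<Longrightarrow> - pi < Im \<mu> \<and> Im \<mu> < pi" and s: "s \<in> {0..1}"
  shows "mat_exp (s *\<^sub>R Y) \<in> log_domain"
  unfolding log_domain_def invertible_iff_ker
proof (intro CollectI ballI allI impI, rule ccontr)
  let ?E = "mat_exp (s *\<^sub>R Y)"
  fix t :: real and x assume t: "t \<in> {0..1}" and x: "segment_to_id t ?E *v x = 0" "x \<noteq> 0"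
  let ?S = "{v. segment_to_id t ?E *v v = 0}"
  have "Y ** (s *\<^sub>R Y) = s *\<^sub>R Y ** Y" by (simp add: matrix_scalar_ac scalar_matrix_assoc)
  then have "?E ** Y = Y ** ?E" by (simp add: matrix_commute_mat_exp)
  then have "segment_to_id t ?E ** Y = Y ** segment_to_id t ?E" by (rule segment_to_id_commute)
  then have inv: "Y *v v \<in> ?S" if "v \<in> ?S" for v
    using that by (simp add: matrix_vector_mul_assoc) (simp flip: matrix_vector_mul_assoc)
  have "vec.subspace ?S"
    by (rule vec.subspaceI) (simp_all add: matrix_vector_right_distrib vector_scalar_commute)
  then obtain u \<mu> where u: "u \<in> ?S" "u \<noteq> 0" "Y *v u = \<mu> *s u"
    using exists_eigenvector[of ?S Y x] inv x by auto
  let ?e = "exp (of_real s * \<mu>)"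
  have "(s *\<^sub>R Y) *v u = (of_real s * \<mu>) *s u"
    using u(3) by (simp add: scaleR_matrix_vector_mult scaleR_eq_smult vector_smult_assoc)
  then have "segment_to_id t ?E *v u = (of_real t * (?e - 1) + 1) *s u"
    by (intro segment_to_id_eigenvector mat_exp_eigenvector)
  then have "(of_real t * (?e - 1) + 1) *s u = 0" using u(1) by (simp only: mem_Collect_eq)
  then have e: "of_real t * (?e - 1) + 1 = 0" using u(2) unfolding vector_mul_eq_0 by blast
  have "\<bar>s * Im \<mu>\<bar> \<le> 1 * \<bar>Im \<mu>\<bar>" using s unfolding abs_mult by (intro mult_right_mono) auto
  moreover have "\<mu> \<in> eigenvalues Y" using u by (auto simp: eigenvalues_def)
  then have "1 * \<bar>Im \<mu>\<bar> < pi" using strip[of \<mu>] by (simp add: abs_less_iff)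
  ultimately have small: "\<bar>s * Im \<mu>\<bar> < pi" by linarith
  have "t * Im ?e = 0" "t * (Re ?e - 1) + 1 = 0" using arg_cong[OF e, of Im] arg_cong[OF e, of Re] by simp_all
  then have "Im ?e = 0" and re: "t * (Re ?e - 1) + 1 = 0" by auto
  then have "sin (s * Im \<mu>) = 0" by (simp add: Im_exp)
  then have "s * Im \<mu> = 0" using sin_zero_pi_iff[OF small] by simp
  then have "Re ?e > 0" by (auto simp: Re_exp)
  then have "0 < (1 - t) + t * Re ?e"
    using t by (cases "t = 1") (auto intro: add_pos_nonneg)
  with re show False by (simp add: algebra_simps)
qed

text \<open>With \<open>R_t\<close> the resolvent, \<open>t R_t\<close> is an antiderivative of
  \<open>R_t R_t\<close>: its difference quotients are exactly \<open>R_s R_t\<close>, so continuity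
  of the resolvent suffices. The end points contribute \<open>matrix_inv B\<close> and zero.\<close>

lemma has_integral_resolvent_square:
  assumes B: "B \<in> log_domain"
  shows "((\<lambda>t. resolvent t B ** resolvent t B) has_integral matrix_inv B) {0..1}"
proof -
  let ?R = "\<lambda>t. resolvent t B"
  have cont: "continuous_on {0..1} ?R" by (rule continuous_on_resolvent[OF B])
  have diff: "s *\<^sub>R ?R s - t *\<^sub>R ?R t = (s - t) *\<^sub>R (?R s ** ?R t)" if "s \<in> {0..1}" "t \<in> {0..1}" for s t
  proof -
    have inv: "?R s ** segment_to_id s B = mat 1" "segment_to_id t B ** ?R t = mat 1"
      using B that by (auto simp: resolvent_def log_domain_def matrix_inv_left matrix_inv_right)
    have "s *\<^sub>R ?R s - t *\<^sub>R ?R t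
        = s *\<^sub>R (?R s ** (segment_to_id t B ** ?R t)) - t *\<^sub>R (?R s ** segment_to_id s B ** ?R t)"
      using inv by simp
    also have "\<dots> = ?R s ** (s *\<^sub>R segment_to_id t B - t *\<^sub>R segment_to_id s B) ** ?R t"
      by (simp add: matrix_mult_minus_left matrix_mult_minus_right matrix_scalar_ac matrix_mul_assoc
          flip: scalar_matrix_assoc)
    also have "s *\<^sub>R segment_to_id t B - t *\<^sub>R segment_to_id s B = (s - t) *\<^sub>R mat 1"
      by (simp add: segment_to_id_def algebra_simps)
    finally show ?thesis by (simp add: matrix_scalar_ac flip: scalar_matrix_assoc)
  qed
  have "((\<lambda>t. t *\<^sub>R ?R t) has_vector_derivative ?R t ** ?R t) (at t within {0..1})"
    if t: "t \<in> {0..1}" for t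
    unfolding has_vector_derivative_def
  proof (rule has_derivativeI_sandwich[where e = 1 and H = "\<lambda>s. norm (?R s - ?R t) * norm (?R t)"])
    have "(?R \<longlongrightarrow> ?R t) (at t within {0..1})" using cont t unfolding continuous_on_def by blast
    then have "((\<lambda>s. norm (?R s - ?R t) * norm (?R t)) \<longlongrightarrow> norm (?R t - ?R t) * norm (?R t)) (at t within {0..1})"
      by (rule tendsto_mult[OF tendsto_norm[OF tendsto_diff[OF _ tendsto_const]] tendsto_const])
    then show "((\<lambda>s. norm (?R s - ?R t) * norm (?R t)) \<longlongrightarrow> 0) (at t within {0..1})" by simp
    fix s assume s: "s \<in> {0..1}" "s \<noteq> t"
    have "s *\<^sub>R ?R s - t *\<^sub>R ?R t - (s - t) *\<^sub>R (?R t ** ?R t) = (s - t) *\<^sub>R ((?R s - ?R t) ** ?R t)"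
      unfolding diff[OF s(1) t] by (simp add: matrix_mult_minus_left scaleR_right_diff_distrib)
    then show "norm (s *\<^sub>R ?R s - t *\<^sub>R ?R t - (s - t) *\<^sub>R (?R t ** ?R t)) / norm (s - t)
        \<le> norm (?R s - ?R t) * norm (?R t)"
      using s(2) by (simp add: norm_matrix_mult_le)
  qed (auto simp: bounded_linear_scaleR_left)
  from fundamental_theorem_of_calculus[OF _ this]
  have "((\<lambda>t. ?R t ** ?R t) has_integral 1 *\<^sub>R ?R 1 - 0 *\<^sub>R ?R 0) {0..1}" by simp
  then show ?thesis by (simp add: resolvent_def segment_to_id_def)
qed

lemma log_deriv_commute:
  assumes B: "B \<in> log_domain" and E: "B ** E = E ** B"
  shows "log_deriv B E = E ** matrix_inv B"
proof -
  have "log_deriv B E = integral {0..1} (\<lambda>t. E ** (resolvent t B ** resolvent t B))"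
    unfolding log_deriv_def
    by (intro integral_cong) (simp add: resolvent_commute[OF B _ E] matrix_mul_assoc)
  also have "\<dots> = E ** integral {0..1} (\<lambda>t. resolvent t B ** resolvent t B)"
    by (rule integral_matrix_mult_left) (use has_integral_resolvent_square[OF B] in blast)
  finally show ?thesis using has_integral_resolvent_square[OF B] by (simp add: integral_unique)
qed

text \<open>The strip condition keeps the curve \<open>exp (s Y)\<close> in
  \<open>log_domain\<close>. Its derivative commutes with \<open>exp (s Y)\<close>, so by the chain
  rule the logarithm integral along it has the constant derivative \<open>Y\<close>. The difference
  from \<open>s Y\<close> is thus constant, and it vanishes at \<open>s = 0\<close>.\<close>

lemma log_integral_mat_exp:
  fixes Y :: "complex^'n^'n"
  assumes strip: "\<And>\<mu>. \<mu> \<in> eigenvalues Y \<Longrightarrow> - pi < Im \<mu> \<and> Im \<mu> < pi"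
  shows "log_integral (mat_exp Y) = Y"
proof -
  let ?E = "\<lambda>s. mat_exp (s *\<^sub>R Y)"
  let ?g = "\<lambda>s. log_integral (?E s) - s *\<^sub>R Y"
  have "(?g has_vector_derivative 0) (at s within {0..1})" if s: "s \<in> {0..1}" for s
  proof -
    have dom: "?E s \<in> log_domain" by (rule mat_exp_scaleR_in_log_domain[OF strip s])
    have "Y ** (s *\<^sub>R Y) = s *\<^sub>R Y ** Y" by (simp add: matrix_scalar_ac scalar_matrix_assoc)
    then have "?E s ** Y = Y ** ?E s" by (simp add: matrix_commute_mat_exp)
    then have "?E s ** (Y ** ?E s) = Y ** ?E s ** ?E s" by (simp add: matrix_mul_assoc)
    then have "log_deriv (?E s) (Y ** ?E s) = Y ** ?E s ** matrix_inv (?E s)"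
      by (rule log_deriv_commute[OF dom])
    also have "\<dots> = Y"
    proof -
      have "invertible (segment_to_id 1 (?E s))" using dom by (simp add: log_domain_def)
      then have "invertible (?E s)" by (simp add: segment_to_id_def)
      then show ?thesis by (simp add: matrix_inv_right flip: matrix_mul_assoc)
    qed
    finally have Y: "log_deriv (?E s) (Y ** ?E s) = Y" .
    have "((\<lambda>s. log_integral (?E s)) has_derivative (\<lambda>h. log_deriv (?E s) (h *\<^sub>R (Y ** ?E s)))) (at s)"
      by (rule has_derivative_compose[OF has_vector_derivative_mat_exp[unfolded has_vector_derivative_def]
            has_derivative_log_integral[OF dom]])
    then have "((\<lambda>s. log_integral (?E s)) has_vector_derivative Y) (at s)"
      by (simp add: has_vector_derivative_def linear_scale[OF bounded_linear.linear[OF bounded_linear_log_deriv[OF dom]]] Y)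
    moreover have "((\<lambda>s. s *\<^sub>R Y) has_vector_derivative Y) (at s)"
      by (auto intro!: derivative_eq_intros simp: has_vector_derivative_def)
    ultimately have "(?g has_vector_derivative Y - Y) (at s)"
      by (rule has_vector_derivative_diff)
    then show ?thesis by (simp add: has_vector_derivative_at_within)
  qed
  from has_vector_derivative_zero_constant[OF convex_real_interval(5) this]
  obtain c where c: "\<And>s. s \<in> {0..1} \<Longrightarrow> ?g s = c" by blast
  have "?g 0 = 0" by (simp add: log_integral_def)
  then have "?g 1 = 0" using c[of 0] c[of 1] by simp
  then show ?thesis by simp
qed

section \<open>Spectrum of the logarithm integral\<close>

lemma log_domain_eigenvalue:
  assumes B: "B \<in> log_domain" and u: "B *v u = \<beta> *s u" "u \<noteq> 0" and t: "t \<in> {0..1}"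
  shows "of_real t * (\<beta> - 1) + 1 \<notin> \<real>\<^sub>\<le>\<^sub>0"
proof
  assume "of_real t * (\<beta> - 1) + 1 \<in> \<real>\<^sub>\<le>\<^sub>0"
  then obtain r where r: "r \<le> 0" "of_real t * (\<beta> - 1) + 1 = complex_of_real r"
    by (auto elim: nonpos_Reals_cases)
  \<comment> \<open>From \<open>t (\<beta> - 1) = r - 1\<close> it follows that
    \<open>?t (\<beta> - 1) = -1\<close>, so the segment is singular at \<open>?t\<close>, which
    lies in \<open>[0,1]\<close> because \<open>r \<le> 0\<close>.\<close>
  let ?t = "t / (1 - r)"
  have "?t \<in> {0..1}" using t r(1) by (auto simp: divide_simps)
  have "of_real ?t * (\<beta> - 1) = complex_of_real ((r - 1) / (1 - r))"
    using r(2) by (simp add: eq_diff_eq[symmetric] divide_simps)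
  also have "(r - 1) / (1 - r) = - 1" using r(1) by (simp add: divide_simps)
  finally have "segment_to_id ?t B *v u = 0" by (simp add: segment_to_id_eigenvector[OF u(1)])
  moreover have "invertible (segment_to_id ?t B)" using B \<open>?t \<in> {0..1}\<close> by (auto simp: log_domain_def)
  ultimately show False using u(2) by (simp add: invertible_iff_ker)
qed

lemma resolvent_eigenvector:
  assumes B: "B \<in> log_domain" and u: "B *v u = \<beta> *s u" "u \<noteq> 0" and t: "t \<in> {0..1}"
  shows "resolvent t B *v u = inverse (of_real t * (\<beta> - 1) + 1) *s u"
proof -
  let ?c = "of_real t * (\<beta> - 1) + 1"
  have "?c \<noteq> 0" using log_domain_eigenvalue[OF assms] by auto
  then have "u = segment_to_id t B *v (inverse ?c *s u)"
    by (simp only: vector_scalar_commute segment_to_id_eigenvector[OF u(1)] vector_smult_assoc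
        left_inverse[OF \<open>?c \<noteq> 0\<close>] vector_smult_lid)
  moreover have "invertible (segment_to_id t B)" using B t by (auto simp: log_domain_def)
  ultimately show ?thesis unfolding resolvent_def by (metis matrix_inv_vector(2))
qed

text \<open>On an eigenvector the integral becomes scalar, with antiderivative
  \<open>Ln (t (\<beta> - 1) + 1)\<close>; the path stays off the branch cut.\<close>

lemma log_integral_eigenvector:
  assumes B: "B \<in> log_domain" and u: "B *v u = \<beta> *s u" "u \<noteq> 0"
  shows "log_integral B *v u = Ln \<beta> *s u"
proof -
  let ?c = "\<lambda>t. of_real t * (\<beta> - 1) + 1 :: complex"
  have deriv: "((\<lambda>t. Ln (?c t)) has_vector_derivative (\<beta> - 1) * inverse (?c t)) (at t within {0..1})"
    if "t \<in> {0..1}" for t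
  proof -
    have "?c t \<notin> \<real>\<^sub>\<le>\<^sub>0" by (rule log_domain_eigenvalue[OF B u that])
    then have "((\<lambda>z. Ln (z * (\<beta> - 1) + 1)) has_field_derivative (\<beta> - 1) * inverse (?c t)) (at (of_real t))"
      by (auto intro!: derivative_eq_intros simp: divide_inverse)
    then show ?thesis by (rule has_vector_derivative_real_field)
  qed
  from fundamental_theorem_of_calculus[OF _ this]
  have "((\<lambda>t. (\<beta> - 1) * inverse (?c t)) has_integral Ln (?c 1) - Ln (?c 0)) {0..1}" by simp
  then have int: "((\<lambda>t. (\<beta> - 1) * inverse (?c t)) has_integral Ln \<beta>) {0..1}" by simp
  have "log_integral B *v u = integral {0..1} (\<lambda>t. ((B - mat 1) ** resolvent t B) *v u)"
    unfolding log_integral_def by (rule integral_matrix_vector_mult[OF integrable_log_integrand[OF B]])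
  also have "\<dots> = integral {0..1} (\<lambda>t. ((\<beta> - 1) * inverse (?c t)) *s u)"
    by (intro integral_cong)
      (simp add: resolvent_eigenvector[OF B u] vector_scalar_commute matrix_vector_mult_diff_rdistrib u
        vector_smult_assoc vector_sub_rdistrib vector_ssub_ldistrib algebra_simps
        flip: matrix_vector_mul_assoc)
  also have "\<dots> = Ln \<beta> *s u"
    using has_integral_linear[OF int bounded_linear_smult_left, of u]
    by (simp add: o_def integral_unique)
  finally show ?thesis .
qed

lemma log_integral_commute:
  assumes B: "B \<in> log_domain" and N: "B ** N = N ** B"
  shows "log_integral B ** N = N ** log_integral B"
  unfolding log_integral_def
  by (simp add: integral_matrix_mult_left[symmetric] integral_matrix_mult_right[symmetric]
      integrable_log_integrand[OF B] cong: integral_cong)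
    (intro integral_cong, simp add: resolvent_commute[OF B _ N] matrix_mult_minus_left matrix_mult_minus_right
      N matrix_mul_assoc flip: matrix_mul_assoc[of _ "resolvent _ B"])

text \<open>The eigenspace for \<mu> is invariant under \<open>B\<close> and so contains an
  eigenvector of \<open>B\<close>, with eigenvalue \<beta> say. Hence
  \<open>\<mu> = Ln \<beta>\<close>, and both inequalities are strict because \<beta> avoids the
  cut.\<close>

lemma log_integral_strip:
  assumes B: "B \<in> log_domain" and \<mu>: "\<mu> \<in> eigenvalues (log_integral B)"
  shows "- pi < Im \<mu> \<and> Im \<mu> < pi"
proof -
  obtain x where x: "x \<noteq> 0" "log_integral B *v x = \<mu> *s x" using \<mu> by (auto simp: eigenvalues_def)
  let ?S = "{v. log_integral B *v v = \<mu> *s v}"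
  have "vec.subspace ?S"
    by (rule vec.subspaceI)
      (simp_all add: matrix_vector_right_distrib vector_scalar_commute vector_add_ldistrib
        vector_smult_assoc mult.commute)
  moreover have "log_integral B ** B = B ** log_integral B" by (rule log_integral_commute[OF B]) simp
  then have "B *v v \<in> ?S" if "v \<in> ?S" for v
    using that by (simp add: matrix_vector_mul_assoc) (simp add: vector_scalar_commute flip: matrix_vector_mul_assoc)
  ultimately obtain u \<beta> where u: "u \<in> ?S" "u \<noteq> 0" "B *v u = \<beta> *s u"
    using exists_eigenvector[of ?S B x] x by auto
  have "\<mu> = Ln \<beta>" using log_integral_eigenvector[OF B u(3,2)] u by simp
  moreover have "\<beta> \<notin> \<real>\<^sub>\<le>\<^sub>0" using log_domain_eigenvalue[OF B u(3,2), of 1] by simp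
  ultimately show ?thesis
    using mpi_less_Im_Ln[of \<beta>] Im_Ln_less_pi[of \<beta>] by (metis nonpos_Reals_zero_I)
qed

text \<open>The exponential \<open>C\<close> commutes with \<open>B\<close> and has the same
  logarithm integral. The difference formula becomes \<open>0 = (C - B) K\<close>, where
  \<open>K\<close> integrates the product of the two resolvents, and invertibility of
  \<open>K\<close> gives \<open>C = B\<close>.\<close>

lemma mat_exp_log_integral:
  fixes B :: "complex^'n^'n"
  assumes B: "B \<in> log_domain"
  shows "mat_exp (log_integral B) = B"
proof -
  define C where "C = mat_exp (log_integral B)"
  have C: "C \<in> log_domain"
    using mat_exp_scaleR_in_log_domain[of "log_integral B" 1] log_integral_strip[OF B] by (simp add: C_def)
  have eq: "log_integral C = log_integral B"
    unfolding C_def by (rule log_integral_mat_exp) (rule log_integral_strip[OF B])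
  have "B ** log_integral B = log_integral B ** B"
    by (rule log_integral_commute[OF B refl, symmetric])
  then have BC: "B ** C = C ** B" unfolding C_def by (rule matrix_commute_mat_exp)
  have com: "resolvent t B ** N = N ** resolvent t B" "resolvent t C ** N = N ** resolvent t C"
    if "t \<in> {0..1}" "N = B \<or> N = C" for t N
    using that BC by (auto intro!: resolvent_commute B C)
  define K where "K = integral {0..1} (\<lambda>t. resolvent t B ** resolvent t C)"
  have int: "(\<lambda>t. resolvent t B ** resolvent t C) integrable_on {0..1}"
    using integrable_sandwich[OF B C, of "mat 1"] by simp
  have KN: "K ** N = N ** K" if "N = B \<or> N = C" for N
    unfolding K_def integral_matrix_mult_left[OF int, symmetric] integral_matrix_mult_right[OF int, symmetric]
    by (intro integral_cong) (metis com[OF _ that] matrix_mul_assoc)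
  \<comment> \<open>A nontrivial kernel of \<open>K\<close> is invariant under \<open>B\<close> and
    \<open>C\<close>, hence contains a common eigenvector. Equal logarithms force equal eigenvalues,
    so on this vector \<open>K\<close> acts like the integral of the squared resolvent of
    \<open>B\<close>, that is, like the injective \<open>matrix_inv B\<close>.\<close>
  have ker: "K *v w = 0 \<longrightarrow> w = 0" for w
  proof (rule ccontr)
    assume "\<not> (K *v w = 0 \<longrightarrow> w = 0)"
    then have w: "w \<in> {v. K *v v = 0}" "w \<noteq> 0" by auto
    have N: "N *v v \<in> {v. K *v v = 0}" if "v \<in> {v. K *v v = 0}" "N = B \<or> N = C" for v N
      using that KN by (simp add: matrix_vector_mul_assoc) (simp flip: matrix_vector_mul_assoc)
    have S: "vec.subspace {v. K *v v = 0}"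
      by (rule vec.subspaceI) (simp_all add: matrix_vector_right_distrib vector_scalar_commute)
    obtain u1 \<beta> where u1: "u1 \<in> {v. K *v v = 0}" "u1 \<noteq> 0" "B *v u1 = \<beta> *s u1"
      using exists_eigenvector[OF S N w] by blast
    let ?S = "{v. K *v v = 0 \<and> B *v v = \<beta> *s v}"
    have "vec.subspace ?S"
      by (rule vec.subspaceI)
        (simp_all add: matrix_vector_right_distrib vector_scalar_commute vector_add_ldistrib
          vector_smult_assoc mult.commute)
    moreover have "C *v v \<in> ?S" if "v \<in> ?S" for v
    proof -
      have "B *v (C *v v) = C *v (B *v v)" by (simp add: matrix_vector_mul_assoc BC)
      then show ?thesis using that N[of v C] by (simp add: vector_scalar_commute)
    qed
    ultimately obtain u \<gamma> where u: "u \<in> ?S" "u \<noteq> 0" "C *v u = \<gamma> *s u"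
      using exists_eigenvector[of ?S C u1] u1 by blast
    have Bu: "B *v u = \<beta> *s u" using u by simp
    have "Ln \<beta> = Ln \<gamma>"
      using log_integral_eigenvector[OF B Bu u(2)] log_integral_eigenvector[OF C u(3,2)] u(2)
      by (simp add: eq)
    moreover have "\<beta> \<noteq> 0" "\<gamma> \<noteq> 0"
      using log_domain_eigenvalue[OF B Bu u(2), of 1] log_domain_eigenvalue[OF C u(3,2), of 1] by auto
    ultimately have "\<beta> = \<gamma>" by (metis exp_Ln)
    have "K *v u = integral {0..1} (\<lambda>t. (resolvent t B ** resolvent t C) *v u)"
      unfolding K_def by (rule integral_matrix_vector_mult[OF int])
    also have "\<dots> = integral {0..1} (\<lambda>t. (resolvent t B ** resolvent t B) *v u)"
      by (intro integral_cong) (simp add: resolvent_eigenvector[OF B Bu u(2)]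
          resolvent_eigenvector[OF C u(3,2)] \<open>\<beta> = \<gamma>\<close> flip: matrix_vector_mul_assoc)
    also have "\<dots> = matrix_inv B *v u"
      using has_integral_resolvent_square[OF B]
      by (subst integral_matrix_vector_mult[symmetric]) (auto simp: integral_unique)
    finally have "matrix_inv B *v u = 0" using u by simp
    moreover have "invertible B" using B by (auto simp: log_domain_def segment_to_id_def dest: bspec[of _ _ 1])
    ultimately show False using u(2) matrix_inv_vector(1)[of B u] by simp
  qed
  have "0 = log_integral C - log_integral B" by (simp add: eq)
  also have "\<dots> = integral {0..1} (\<lambda>t. (C - B) ** (resolvent t B ** resolvent t C))"
    unfolding log_integral_diff[OF B C]
    by (intro integral_cong) (simp add: com matrix_mult_minus_left matrix_mult_minus_right matrix_mul_assoc)
  also have "\<dots> = (C - B) ** K" unfolding K_def by (rule integral_matrix_mult_left[OF int])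
  finally have "(C - B) ** K ** matrix_inv K = 0" by simp
  moreover have "invertible K" using ker by (simp add: invertible_iff_ker)
  ultimately have "C - B = 0" by (simp add: matrix_inv_right flip: matrix_mul_assoc)
  then show ?thesis by (simp add: C_def)
qed

section \<open>Identification with the principal logarithm\<close>

lemma mat_log_eq:
  assumes "B \<in> log_domain"
  shows "mat_log B = log_integral B"
  unfolding mat_log_def
proof (rule the_equality)
  show "X = log_integral B" if "mat_exp X = B \<and> (\<forall>\<mu>\<in>eigenvalues X. - pi < Im \<mu> \<and> Im \<mu> < pi)" for X
    using that log_integral_mat_exp[of X] by simp
qed (use mat_exp_log_integral[OF assms] log_integral_strip[OF assms] in blast)

text \<open>As \<open>log_domain\<close> is open, \<open>mat_log\<close> and
  \<open>log_integral\<close> agree near \<open>B\<close>, and the derivative carries over.\<close>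

lemma has_derivative_mat_log:
  assumes B: "B \<in> log_domain"
  shows "(mat_log has_derivative log_deriv B) (at B)"
proof -
  obtain c where c: "c > 0" "\<And>t B'. t \<in> {0..1} \<Longrightarrow> norm (B' - B) \<le> c \<Longrightarrow> bounded_below c (segment_to_id t B')"
    using log_domain_nhd[OF B] by blast
  show ?thesis
  proof (rule has_derivative_transform_within[OF has_derivative_log_integral[OF B] c(1)])
    fix B' assume "dist B' B < c"
    then have "norm (B' - B) \<le> c" by (simp add: dist_norm)
    then have "B' \<in> log_domain" using log_domainI[OF c(2) c(1)] by blast
    then show "log_integral B' = mat_log B'" by (simp add: mat_log_eq)
  qed simp
qed

lemma smult_mat_nth [simp]: "(c *sm M) $ i $ j = c * M $ i $ j"
  by (simp add: smult_mat_def)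

lemma smult_mat_mult: "M ** (c *sm N) = c *sm (M ** N)" "(c *sm M) ** N = c *sm (M ** N)"
  by (simp_all add: vec_eq_iff matrix_matrix_mult_def sum_distrib_left mult_ac)

lemma smult_mat_vector_mult: "(c *sm M) *v x = c *s (M *v x)"
  by (simp add: vec_eq_iff matrix_vector_mult_def sum_distrib_left mult_ac)

lemma bounded_linear_smult_mat: "bounded_linear (\<lambda>M :: complex^'n^'m. c *sm M)"
  by (simp add: linear_conv_bounded_linear[symmetric] linear_iff vec_eq_iff algebra_simps)

lemma frechet_deriv_mat_log:
  assumes B: "B \<in> log_domain"
  shows "frechet_deriv mat_log B = log_deriv B"
  unfolding frechet_deriv_def
proof (rule the_equality, intro conjI allI)
  show "log_deriv B (c *sm E) = c *sm log_deriv B E" for c E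
    unfolding log_deriv_def smult_mat_mult
    using integral_linear[OF integrable_sandwich[OF B B] bounded_linear_smult_mat] by (simp add: o_def)
qed (use has_derivative_mat_log[OF B] has_derivative_unique in blast)+

section \<open>The Galerkin approximation\<close>

text \<open>In operator form, \<open>P^2 \<le> d P\<close>. Nonnegativity of the form at
  \<open>x - s P x\<close> is exploited with \<open>s = 1 / d\<close>, which avoids a spectral
  decomposition.\<close>

lemma psd_norm_square_le:
  fixes P :: "'a::real_inner \<Rightarrow> 'a"
  assumes "linear P" and sym: "\<And>x y. P x \<bullet> y = x \<bullet> P y" and psd: "\<And>x. 0 \<le> x \<bullet> P x"
    and le: "\<And>x. x \<bullet> P x \<le> d * (norm x)\<^sup>2" and "d \<ge> 0"
  shows "(norm (P x))\<^sup>2 \<le> d * (x \<bullet> P x)"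
proof -
  interpret linear P by fact
  define b c where "b = x \<bullet> P x" and "c = (norm (P x))\<^sup>2"
  have bc: "b \<ge> 0" "c \<ge> 0" using psd by (auto simp: b_def c_def)
  have quad: "0 \<le> b - 2 * s * c + s\<^sup>2 * (d * c)" for s
  proof -
    have "0 \<le> (x - s *\<^sub>R P x) \<bullet> P (x - s *\<^sub>R P x)" by (rule psd)
    also have "\<dots> = b - 2 * s * c + s\<^sup>2 * (P x \<bullet> P (P x))"
      using sym[of x "P x"] unfolding b_def c_def power2_norm_eq_inner
      by (simp add: diff scale inner_diff_left inner_diff_right power2_eq_square algebra_simps)
    also have "\<dots> \<le> b - 2 * s * c + s\<^sup>2 * (d * c)"
      unfolding c_def using le[of "P x"] by (intro add_left_mono mult_left_mono) auto
    finally show ?thesis .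
  qed
  have "c \<le> d * b"
  proof (cases "d = 0")
    case True
    have "c = 0"
    proof (rule ccontr)
      assume "c \<noteq> 0"
      \<comment> \<open>For \<open>d = 0\<close> the inequality is linear in \<open>s\<close>, and
        this \<open>s\<close> is large enough to violate it.\<close>
      then have "0 \<le> b - 2 * (b + 1)" using quad[of "(b + 1) / c"] True by simp
      then show False using bc by simp
    qed
    then show ?thesis using True by simp
  next
    case False
    then have "0 \<le> b - c / d" using quad[of "1 / d"] by (simp add: power2_eq_square)
    then show ?thesis using False \<open>d \<ge> 0\<close> by (simp add: field_simps)
  qed
  then show ?thesis by (simp add: b_def c_def)
qed

text \<open>The preceding bound applies with \<open>d\<close> an operator bound for
  \<open>P\<close>. The purpose is to turn minimality of a Rayleigh quotient into an eigenvector
  equation.\<close>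

lemma psd_form_zero:
  fixes P :: "'a::euclidean_space \<Rightarrow> 'a"
  assumes lin: "linear P" and sym: "\<And>x y. P x \<bullet> y = x \<bullet> P y" and psd: "\<And>x. 0 \<le> x \<bullet> P x"
    and "x \<bullet> P x = 0"
  shows "P x = 0"
proof -
  obtain d where d: "d > 0" "\<And>x. norm (P x) \<le> d * norm x"
    using linear_bounded_pos[OF lin] by blast
  have "x \<bullet> P x \<le> d * (norm x)\<^sup>2" for x
  proof -
    have "x \<bullet> P x \<le> norm x * norm (P x)" by (rule norm_cauchy_schwarz)
    also have "\<dots> \<le> norm x * (d * norm x)" by (intro mult_left_mono d) simp
    finally show ?thesis by (simp add: power2_eq_square algebra_simps)
  qed
  from psd_norm_square_le[OF lin sym psd this, of x] d(1) assms(4) show ?thesis by simp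
qed

text \<open>In terms of \<open>Y = (\<beta> + \<alpha>) - 2 A\<close>, \<open>\<delta> = \<beta> - \<alpha>\<close> and \<open>D = \<delta>\<^sup>2 - Y\<^sup>2\<close>, the vectors \<open>a\<close> and \<open>b\<close> of the
  induction are \<open>\<delta>\<^sup>k T\<^sub>k(Y / \<delta>) u\<close> and \<open>\<delta>\<^bsup>k-1\<^esup> U\<^bsub>k-1\<^esub>(Y / \<delta>) u\<close> with the Chebyshev polynomials
  of both kinds. The Pell equation \<open>T\<^sub>k\<^sup>2 + (1 - x\<^sup>2) U\<^bsub>k-1\<^esub>\<^sup>2 = 1\<close> turns into a conserved quadratic
  form, which bounds \<open>a\<close> without recourse to the spectral theorem; the scaling by powers of \<open>\<delta>\<close>
  covers the case \<open>\<alpha> = \<beta>\<close>. The scalars \<open>\<tau>\<close> and \<open>\<sigma>\<close> are the values of the same polynomials at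
  the point that corresponds to the argument \<open>0\<close> for \<open>A\<close>.\<close>

lemma chebyshev_approximation:
  fixes A :: "'a::real_inner \<Rightarrow> 'a" and K :: "nat \<Rightarrow> 'a set"
  assumes lin: "linear A" and sym: "\<And>x y. A x \<bullet> y = x \<bullet> A y"
    and lower: "\<And>x. \<alpha> * (norm x)\<^sup>2 \<le> x \<bullet> A x" and upper: "\<And>x. x \<bullet> A x \<le> \<beta> * (norm x)\<^sup>2"
    and \<alpha>: "0 < \<alpha>" "\<alpha> \<le> \<beta>"
    and K: "\<And>j. subspace (K j)" "\<And>j. K j \<subseteq> K (Suc j)" "\<And>j x. x \<in> K j \<Longrightarrow> A x \<in> K (Suc j)"
    and u: "A u \<in> K 1"
  obtains x where "x \<in> K m"
    "(u - x) \<bullet> A (u - x) \<le> (2 * ((sqrt \<beta> - sqrt \<alpha>) / (sqrt \<beta> + sqrt \<alpha>)) ^ m)\<^sup>2 * (u \<bullet> A u)"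
proof -
  interpret linear A by fact
  define s \<delta> \<omega> where "s = \<beta> + \<alpha>" and "\<delta> = \<beta> - \<alpha>" and "\<omega> = 2 * (sqrt \<alpha> * sqrt \<beta>)"
  define Y where "Y x = s *\<^sub>R x - (2 *\<^sub>R A x)" for x
  define D where "D x = \<delta>\<^sup>2 *\<^sub>R x - Y (Y x)" for x
  have \<omega>: "\<omega>\<^sup>2 = s\<^sup>2 - \<delta>\<^sup>2"
    using \<alpha> by (simp add: \<omega>_def s_def \<delta>_def power2_eq_square algebra_simps)
  have "\<delta> \<ge> 0" using \<alpha> by (simp add: \<delta>_def)
  interpret Y: linear Y
    by (rule linearI) (simp_all add: Y_def add scale algebra_simps)
  interpret D: linear D
    by (rule linearI) (simp_all add: D_def Y.add Y.scale algebra_simps)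
  have AY: "A (Y x) = Y (A x)" for x by (simp add: Y_def diff scale)
  have AD: "A (D x) = D (A x)" for x by (simp add: D_def diff scale AY)
  have YD: "Y (D x) = D (Y x)" for x by (simp add: D_def Y.diff Y.scale)
  have symY: "Y x \<bullet> y = x \<bullet> Y y" for x y by (simp add: Y_def algebra_simps sym)
  have symD: "D x \<bullet> y = x \<bullet> D y" for x y by (simp add: D_def algebra_simps symY)
  \<comment> \<open>With \<open>P = \<beta> - A\<close> and \<open>Q = A - \<alpha>\<close>, the
    operator \<open>D\<close> factors as \<open>4 P Q\<close>, and
    \<open>A P Q = \<alpha> P Q + Q P Q\<close>. The first summand is nonnegative since
    \<open>P Q = \<delta> P - P^2\<close>, to which \<open>psd_norm_square_le\<close> applies; the
    second since \<open>P\<close> is.\<close>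
  have psd: "0 \<le> x \<bullet> A (D x)" for x
  proof -
    define P Q where "P x = \<beta> *\<^sub>R x - A x" and "Q x = A x - \<alpha> *\<^sub>R x" for x
    have linP: "linear P" by (rule linearI) (simp_all add: P_def add scale algebra_simps)
    have symP: "P x \<bullet> y = x \<bullet> P y" for x y by (simp add: P_def algebra_simps sym)
    have posP: "0 \<le> x \<bullet> P x" for x using upper[of x] by (simp add: P_def algebra_simps power2_norm_eq_inner)
    have "x \<bullet> P x \<le> \<delta> * (norm x)\<^sup>2" for x
      using lower[of x] by (simp add: P_def \<delta>_def algebra_simps power2_norm_eq_inner)
    from psd_norm_square_le[OF linP symP posP this \<open>\<delta> \<ge> 0\<close>, of x]
    have "0 \<le> \<delta> * (x \<bullet> P x) - P x \<bullet> P x" by (simp add: power2_norm_eq_inner)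
    also have "\<dots> = x \<bullet> P (Q x)"
      by (simp add: P_def Q_def \<delta>_def diff scale sym algebra_simps)
    finally have PQ: "0 \<le> \<alpha> * (x \<bullet> P (Q x))" using \<alpha> by simp
    have "x \<bullet> A (D x) = 4 * (x \<bullet> A (P (Q x)))"
      by (simp add: D_def Y_def P_def Q_def s_def \<delta>_def diff add scale power2_eq_square algebra_simps)
    also have "x \<bullet> A (P (Q x)) = \<alpha> * (x \<bullet> P (Q x)) + Q x \<bullet> P (Q x)"
      by (simp add: P_def Q_def diff add scale sym algebra_simps)
    finally show ?thesis using PQ posP[of "Q x"] by simp
  qed
  \<comment> \<open>For \<open>x = p(A) u\<close>, the scalar \<xi> tracks the constant coefficient
    \<open>p(0)\<close>. The other terms lie in the spaces \<open>K j\<close> because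
    \<open>A u\<close> lies in \<open>K 1\<close>, whereas \<open>u\<close> itself may lie outside
    all of them.\<close>
  define mem where "mem j x \<xi> \<longleftrightarrow> x - \<xi> *\<^sub>R u \<in> K j" for j x and \<xi> :: real
  have u': "A u \<in> K (Suc j)" for j
  proof (induction j)
    case 0
    then show ?case using u by simp
  next
    case (Suc j)
    then show ?case using K(2) by blast
  qed
  have mem_Y: "mem (Suc j) (Y x) (s * \<xi>)" if "mem j x \<xi>" for j x \<xi>
  proof -
    let ?k = "x - \<xi> *\<^sub>R u"
    have "Y x - (s * \<xi>) *\<^sub>R u = s *\<^sub>R ?k - (2 *\<^sub>R A ?k + (2 * \<xi>) *\<^sub>R A u)"
      by (simp add: Y_def diff scale algebra_simps)
    moreover have "?k \<in> K (Suc j)" "A ?k \<in> K (Suc j)" using that K(2,3) by (auto simp: mem_def)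
    ultimately show ?thesis
      unfolding mem_def by (simp add: subspace_diff subspace_add subspace_scale K(1) u')
  qed
  have mem_add: "mem j (x + y) (\<xi> + \<zeta>)" if "mem j x \<xi>" "mem j y \<zeta>" for j x y \<xi> \<zeta>
  proof -
    have "x + y - (\<xi> + \<zeta>) *\<^sub>R u = (x - \<xi> *\<^sub>R u) + (y - \<zeta> *\<^sub>R u)" by (simp add: algebra_simps)
    then show ?thesis using subspace_add[OF K(1) that[unfolded mem_def]] unfolding mem_def by (simp only:)
  qed
  have mem_scale: "mem j (c *\<^sub>R x) (c * \<xi>)" if "mem j x \<xi>" for j x \<xi> c
  proof -
    have "c *\<^sub>R x - (c * \<xi>) *\<^sub>R u = c *\<^sub>R (x - \<xi> *\<^sub>R u)" by (simp add: algebra_simps)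
    then show ?thesis using that subspace_scale[OF K(1)] unfolding mem_def by simp
  qed
  have mem_Suc: "mem (Suc j) x \<xi>" if "mem j x \<xi>" for j x \<xi> using that K(2) by (auto simp: mem_def)
  have mem_diff: "mem j (x - y) (\<xi> - \<zeta>)" if "mem j x \<xi>" "mem j y \<zeta>" for j x y \<xi> \<zeta>
    using mem_add[OF that(1) mem_scale[OF that(2), of "- 1"]] by simp
  have mem_D: "mem (Suc (Suc j)) (D x) ((\<delta>\<^sup>2 - s\<^sup>2) * \<xi>)" if "mem j x \<xi>" for j x \<xi>
    using mem_diff[OF mem_scale[OF mem_Suc[OF mem_Suc[OF that]], of "\<delta>\<^sup>2"] mem_Y[OF mem_Y[OF that]]]
    by (simp add: D_def power2_eq_square algebra_simps)
  have mem_0: "mem j 0 0" for j by (simp add: mem_def subspace_0 K(1))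
  \<comment> \<open>The vector \<open>b\<close> stays one index behind \<open>a\<close>; its value
    at \<open>k = 0\<close> reflects that the polynomial \<open>U\<close> of index -1 is
    zero.\<close>
  have "\<exists>a b \<tau> \<sigma>. a \<bullet> A a + b \<bullet> A (D b) = (\<delta>\<^sup>2) ^ k * (u \<bullet> A u) \<and>
      \<tau> + \<omega> * \<sigma> = (s + \<omega>) ^ k \<and> \<tau> - \<omega> * \<sigma> = (s - \<omega>) ^ k \<and> mem k a \<tau> \<and>
      (case k of 0 \<Rightarrow> b = 0 \<and> \<sigma> = 0 | Suc j \<Rightarrow> mem j b \<sigma>)" for k
  proof (induction k)
    case 0
    show ?case
      by (intro exI[of _ u] exI[of _ 0] exI[of _ 1]) (simp add: mem_def subspace_0 K(1))
  next
    case (Suc k)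
    then obtain a b \<tau> \<sigma> where form: "a \<bullet> A a + b \<bullet> A (D b) = (\<delta>\<^sup>2) ^ k * (u \<bullet> A u)"
      and \<tau>\<sigma>: "\<tau> + \<omega> * \<sigma> = (s + \<omega>) ^ k" "\<tau> - \<omega> * \<sigma> = (s - \<omega>) ^ k"
      and a: "mem k a \<tau>" and b: "case k of 0 \<Rightarrow> b = 0 \<and> \<sigma> = 0 | Suc j \<Rightarrow> mem j b \<sigma>"
      by blast
    \<comment> \<open>Up to powers of \<delta> these are the recurrences
      \<open>T' = x T - (1 - x^2) U\<close> and \<open>U' = x U + T\<close>. The scalars obey them
      with \<open>Y\<close> replaced by \<open>s\<close> and \<open>D\<close> by
      \<open>\<delta>\<^sup>2 - s\<^sup>2 = - \<omega>\<^sup>2\<close>.\<close>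
    let ?a = "Y a - D b" and ?b = "Y b + a"
    let ?\<tau> = "s * \<tau> - (\<delta>\<^sup>2 - s\<^sup>2) * \<sigma>" and ?\<sigma> = "s * \<sigma> + \<tau>"
    have Db: "mem (Suc k) (D b) ((\<delta>\<^sup>2 - s\<^sup>2) * \<sigma>)" and Yb: "mem k (Y b) (s * \<sigma>)"
      using b mem_D[of _ b \<sigma>] mem_Y[of _ b \<sigma>] mem_0 by (auto split: nat.splits simp: D.zero Y.zero)
    \<comment> \<open>\<open>A\<close>, \<open>Y\<close> and \<open>D\<close> commute and are
      symmetric, so all mixed terms equal \<open>a \<bullet> A (D (Y b))\<close> up to sign and
      cancel. The rest collapses through \<open>D + Y^2 = \<delta>^2\<close>.\<close>
    have "?a \<bullet> A ?a + ?b \<bullet> A (D ?b) = \<delta>\<^sup>2 * (a \<bullet> A a + b \<bullet> A (D b))"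
    proof -
      have Dz: "D x \<bullet> z = \<delta>\<^sup>2 * (x \<bullet> z) - Y (Y x) \<bullet> z" for x z
        by (simp add: D_def inner_diff_left)
      have "Y (Y b) \<bullet> A (D b) = Y b \<bullet> A (D (Y b))" by (simp only: symY AY[symmetric] YD)
      then have DD: "D b \<bullet> A (D b) = \<delta>\<^sup>2 * (b \<bullet> A (D b)) - Y b \<bullet> A (D (Y b))"
        by (simp only: Dz)
      have "a \<bullet> A (D a) = D a \<bullet> A a" by (simp only: symD AD)
      also have "\<dots> = \<delta>\<^sup>2 * (a \<bullet> A a) - Y (Y a) \<bullet> A a" by (rule Dz)
      also have "Y (Y a) \<bullet> A a = Y a \<bullet> A (Y a)" by (simp only: symY AY)
      finally have Da: "a \<bullet> A (D a) = \<delta>\<^sup>2 * (a \<bullet> A a) - Y a \<bullet> A (Y a)" .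
      have "Y a \<bullet> A (D b) = a \<bullet> A (D (Y b))" by (simp only: symY AY[symmetric] YD)
      moreover have "D b \<bullet> A (Y a) = Y a \<bullet> A (D b)"
        by (metis inner_commute sym)
      ultimately have e1: "D b \<bullet> A (Y a) = a \<bullet> A (D (Y b))" "Y a \<bullet> A (D b) = a \<bullet> A (D (Y b))"
        by simp_all
      have "Y b \<bullet> A (D a) = D (Y b) \<bullet> A a" by (simp only: symD AD)
      also have "\<dots> = a \<bullet> A (D (Y b))" by (metis inner_commute sym)
      finally have e2: "Y b \<bullet> A (D a) = a \<bullet> A (D (Y b))" .
      show ?thesis
        by (simp add: diff add D.add inner_diff_left inner_diff_right inner_add_left inner_add_right
            DD Da e1 e2 algebra_simps)
    qed
    then have 1: "?a \<bullet> A ?a + ?b \<bullet> A (D ?b) = (\<delta>\<^sup>2) ^ Suc k * (u \<bullet> A u)"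
      by (simp add: form)
    have d: "\<delta>\<^sup>2 - s\<^sup>2 = - (\<omega>\<^sup>2)" using \<omega> by simp
    have "?\<tau> + \<omega> * ?\<sigma> = (s + \<omega>) * (\<tau> + \<omega> * \<sigma>)" "?\<tau> - \<omega> * ?\<sigma> = (s - \<omega>) * (\<tau> - \<omega> * \<sigma>)"
      unfolding d by (simp_all add: algebra_simps power2_eq_square)
    then have 2: "?\<tau> + \<omega> * ?\<sigma> = (s + \<omega>) ^ Suc k" "?\<tau> - \<omega> * ?\<sigma> = (s - \<omega>) ^ Suc k"
      by (simp_all add: \<tau>\<sigma>)
    show ?case
      using 1 2 mem_diff[OF mem_Y[OF a] Db] mem_add[OF Yb a]
      by (intro exI[of _ ?a] exI[of _ ?b] exI[of _ ?\<tau>] exI[of _ ?\<sigma>]) simp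
  qed
  then obtain a b \<tau> \<sigma> where form: "a \<bullet> A a + b \<bullet> A (D b) = (\<delta>\<^sup>2) ^ m * (u \<bullet> A u)"
    and \<tau>\<sigma>: "\<tau> + \<omega> * \<sigma> = (s + \<omega>) ^ m" "\<tau> - \<omega> * \<sigma> = (s - \<omega>) ^ m" and a: "mem m a \<tau>"
    by blast
  \<comment> \<open>Both numbers are squares; hence \<open>s - \<omega>\<close> is nonnegative, and
    adding the two equations for \<tau> and \<sigma> bounds \<open>2 \<tau>\<close> below by
    \<open>(s + \<omega>)^m\<close>.\<close>
  have r: "s + \<omega> = (sqrt \<beta> + sqrt \<alpha>)\<^sup>2" "s - \<omega> = (sqrt \<beta> - sqrt \<alpha>)\<^sup>2"
    using \<alpha> by (simp_all add: s_def \<omega>_def power2_eq_square algebra_simps)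
  have rpos: "s + \<omega> > 0" unfolding r using \<alpha> by (intro zero_less_power add_nonneg_pos) auto
  have \<tau>: "(s + \<omega>) ^ m \<le> 2 * \<tau>" using \<tau>\<sigma> r by (smt (verit) zero_le_power2 zero_le_power)
  then have "\<tau> > 0" using zero_less_power[OF rpos, of m] by linarith
  \<comment> \<open>Division by \<tau> normalises the constant coefficient of \<open>a\<close> to 1,
    so the multiples of \<open>u\<close> cancel in \<open>x\<close>.\<close>
  define x where "x = u - (1 / \<tau>) *\<^sub>R a"
  show ?thesis
  proof
    have x: "x = (- 1 / \<tau>) *\<^sub>R (a - \<tau> *\<^sub>R u)" using \<open>\<tau> > 0\<close> by (simp add: x_def algebra_simps)
    show "x \<in> K m" unfolding x by (rule subspace_scale[OF K(1) a[unfolded mem_def]])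
    have "u \<bullet> A u \<ge> 0" using lower[of u] \<alpha> by (meson mult_nonneg_nonneg order_trans less_imp_le zero_le_power2)
    have "(u - x) \<bullet> A (u - x) = (1 / \<tau>)\<^sup>2 * (a \<bullet> A a)" by (simp add: x_def scale power2_eq_square)
    also have "\<dots> \<le> (1 / \<tau>)\<^sup>2 * ((\<delta>\<^sup>2) ^ m * (u \<bullet> A u))"
      using form psd[of b] by (intro mult_left_mono) auto
    also have "\<dots> = (\<delta> ^ m / \<tau>)\<^sup>2 * (u \<bullet> A u)" by (simp add: power_divide power_mult_distrib flip: power_mult) (simp add: mult.commute)
    also have "\<dots> \<le> (2 * (\<delta> / (s + \<omega>)) ^ m)\<^sup>2 * (u \<bullet> A u)"
    proof (intro mult_right_mono power_mono)
      have "\<delta> ^ m * (s + \<omega>) ^ m \<le> \<delta> ^ m * (2 * \<tau>)"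
        using \<tau> \<open>\<delta> \<ge> 0\<close> by (intro mult_left_mono) auto
      then show "\<delta> ^ m / \<tau> \<le> 2 * (\<delta> / (s + \<omega>)) ^ m"
        using \<open>\<tau> > 0\<close> rpos by (simp add: power_divide field_simps)
    qed (use \<open>\<tau> > 0\<close> \<open>\<delta> \<ge> 0\<close> \<open>u \<bullet> A u \<ge> 0\<close> in auto)
    also have "\<delta> / (s + \<omega>) = (sqrt \<beta> - sqrt \<alpha>) / (sqrt \<beta> + sqrt \<alpha>)"
    proof -
      have "\<delta> = (sqrt \<beta> + sqrt \<alpha>) * (sqrt \<beta> - sqrt \<alpha>)" using \<alpha> by (simp add: \<delta>_def algebra_simps)
      then show ?thesis using rpos unfolding r by (simp add: power2_eq_square)
    qed
    finally show "(u - x) \<bullet> A (u - x) \<le> (2 * ((sqrt \<beta> - sqrt \<alpha>) / (sqrt \<beta> + sqrt \<alpha>)) ^ m)\<^sup>2 * (u \<bullet> A u)" .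
  qed
qed

section \<open>Adjoints, compressions and Galerkin solutions\<close>

lemma inner_eq_Re_cinner: "x \<bullet> y = Re (cinner x y)" for x y :: "complex^'n"
  by (simp add: inner_vec_def cinner_def inner_complex_def)

lemma ctranspose_nth [simp]: "ctranspose M $ i $ j = cnj (M $ j $ i)"
  by (simp add: ctranspose_def transpose_def)

lemma cinner_matrix_vector_mult: "cinner (M *v x) y = cinner x (ctranspose M *v y)"
  for M :: "complex^'n^'m"
  unfolding cinner_def matrix_vector_mult_def
  by (simp add: sum_distrib_left sum_distrib_right mult_ac) (rule sum.swap)

lemma inner_matrix_vector_mult: "(M *v x) \<bullet> y = x \<bullet> (ctranspose M *v y)"
  for M :: "complex^'n^'m"
  by (simp add: inner_eq_Re_cinner cinner_matrix_vector_mult)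

lemma ctranspose_ctranspose [simp]: "ctranspose (ctranspose M) = M"
  by (simp add: vec_eq_iff)

lemma ctranspose_mult: "ctranspose (M ** N) = ctranspose N ** ctranspose M"
  by (simp add: vec_eq_iff matrix_matrix_mult_def mult.commute)

lemma ctranspose_mat_1 [simp]: "ctranspose (mat 1) = mat 1"
  by (simp add: vec_eq_iff mat_def)

lemma ctranspose_segment_to_id: "ctranspose (segment_to_id t B) = segment_to_id t (ctranspose B)"
  by (simp add: vec_eq_iff segment_to_id_def mat_def)

lemma ctranspose_matrix_inv:
  fixes M :: "complex^'n^'n"
  assumes "invertible M"
  shows "ctranspose (matrix_inv M) = matrix_inv (ctranspose M)"
proof -
  have "ctranspose M ** ctranspose (matrix_inv M) = mat 1"
    by (simp add: matrix_inv_left assms flip: ctranspose_mult)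
  then show ?thesis by (simp add: matrix_inv_unique)
qed

lemma coercive_bounded_below:
  assumes "\<And>x. c * (norm x)\<^sup>2 \<le> x \<bullet> (M *v x)"
  shows "bounded_below c M"
  unfolding bounded_below_def
proof
  fix x
  show "c * norm x \<le> norm (M *v x)"
  proof (cases "x = 0")
    case False
    have "norm x * (c * norm x) \<le> norm x * norm (M *v x)"
      using assms[of x] norm_cauchy_schwarz[of x "M *v x"] by (simp add: power2_eq_square algebra_simps)
    then show ?thesis using False by simp
  qed simp
qed

lemma norm_isometry:
  fixes V :: "complex^'m^'n"
  assumes "ctranspose V ** V = mat 1"
  shows "norm (V *v c) = norm c"
  by (simp add: norm_eq_sqrt_inner inner_matrix_vector_mult matrix_vector_mul_assoc assms)

text \<open>If the compression is invertible, this is the vector in the range of \<open>V\<close>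
  whose residual is orthogonal to that range.\<close>

definition galerkin :: "complex^'n^'n \<Rightarrow> complex^'m^'n \<Rightarrow> complex^'n \<Rightarrow> complex^'n" where
  "galerkin A V y = V *v (matrix_inv (ctranspose V ** A ** V) *v (ctranspose V *v y))"

context
  fixes A :: "complex^'n^'n" and V :: "complex^'m^'n" and \<alpha> :: real
  assumes lower: "\<And>x. \<alpha> * (norm x)\<^sup>2 \<le> x \<bullet> (A *v x)" and \<alpha>: "0 < \<alpha>"
    and V: "ctranspose V ** V = mat 1"
begin

lemma compression_coercive: "\<alpha> * (norm c)\<^sup>2 \<le> c \<bullet> (ctranspose V ** A ** V *v c)"
  using lower[of "V *v c"] by (simp add: norm_isometry[OF V] inner_matrix_vector_mult matrix_vector_mul_assoc matrix_mul_assoc)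

lemma norm_galerkin_le: "norm (galerkin A V (V *v c)) \<le> norm c / \<alpha>"
  unfolding galerkin_def norm_isometry[OF V] matrix_vector_mul_assoc[of "ctranspose V"] V
  using norm_matrix_inv_vector_le[OF coercive_bounded_below[OF compression_coercive] \<alpha>] by simp

text \<open>The Galerkin solution minimises the energy norm of the error over the range of
  \<open>V\<close>, so it is at least as good as the Chebyshev approximation from
  \<open>K m\<close>. For the Euclidean norm, coercivity is applied to the error and
  \<open>u \<bullet> A u \<le> 1 / \<alpha>\<close> to the solution; together they give the factor
  \<open>1 / \<alpha>\<close>.\<close>

lemma galerkin_error:
  assumes herm: "ctranspose A = A" and upper: "\<And>x. x \<bullet> (A *v x) \<le> \<beta> * (norm x)\<^sup>2"
    and "\<alpha> \<le> \<beta>" and y: "norm y = 1"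
    and K: "\<And>j. vec.subspace (K j)" "\<And>j. K j \<subseteq> K (Suc j)" "\<And>j x. x \<in> K j \<Longrightarrow> A *v x \<in> K (Suc j)"
    "y \<in> K 1" and KV: "K m \<subseteq> range ((*v) V)"
  shows "norm (matrix_inv A *v y - galerkin A V y)
    \<le> 2 * ((sqrt \<beta> - sqrt \<alpha>) / (sqrt \<beta> + sqrt \<alpha>)) ^ m / \<alpha>"
proof -
  let ?q = "((sqrt \<beta> - sqrt \<alpha>) / (sqrt \<beta> + sqrt \<alpha>)) ^ m" and ?G = "ctranspose V ** A ** V"
  have q: "?q \<ge> 0" using \<alpha> \<open>\<alpha> \<le> \<beta>\<close> by simp
  have sym: "(A *v x) \<bullet> v = x \<bullet> (A *v v)" for x v by (simp add: inner_matrix_vector_mult herm)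
  have subsp: "subspace (K j)" for j
    using K(1)[of j] by (simp add: subspace_def vec.subspace_def scaleR_eq_smult)
  have bbA: "bounded_below \<alpha> A" by (rule coercive_bounded_below[OF lower])
  have invA: "invertible A" by (rule bounded_below_invertible[OF bbA \<alpha>])
  have invG: "invertible ?G"
    by (rule bounded_below_invertible[OF coercive_bounded_below[OF compression_coercive] \<alpha>])
  define u where "u = matrix_inv A *v y"
  define e where "e = u - galerkin A V y"
  have Au: "A *v u = y" by (simp add: u_def matrix_inv_vector invA)
  have "ctranspose V *v (A *v e) = 0"
  proof -
    have "ctranspose V *v (A *v galerkin A V y) = ?G *v (matrix_inv ?G *v (ctranspose V *v y))"
      by (simp add: galerkin_def matrix_vector_mul_assoc matrix_mul_assoc)
    also have "\<dots> = ctranspose V *v y" by (rule matrix_inv_vector(1)[OF invG])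
    finally show ?thesis by (simp add: e_def matrix_vector_mult_diff_distrib Au)
  qed
  then have orth: "(V *v c) \<bullet> (A *v e) = 0" for c by (simp add: inner_matrix_vector_mult)
  obtain x where x: "x \<in> K m" "(u - x) \<bullet> (A *v (u - x)) \<le> (2 * ?q)\<^sup>2 * (u \<bullet> (A *v u))"
    by (rule chebyshev_approximation[of "(*v) A" \<alpha> \<beta> K u m])
      (use sym lower upper \<alpha> \<open>\<alpha> \<le> \<beta>\<close> subsp K Au in auto)
  \<comment> \<open>The difference of the two approximations lies in the range of \<open>V\<close>,
    to which \<open>A e\<close> is orthogonal; Pythagoras in the energy inner product then compares
    their errors.\<close>
  have "galerkin A V y - x \<in> range ((*v) V)"
    using x(1) KV unfolding galerkin_def
    by (auto simp flip: matrix_vector_mult_diff_distrib)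
  then obtain c where c: "galerkin A V y - x = V *v c" by auto
  have "\<alpha> * (norm e)\<^sup>2 \<le> e \<bullet> (A *v e)" by (rule lower)
  also have "\<dots> \<le> e \<bullet> (A *v e) + (V *v c) \<bullet> (A *v (V *v c))"
    using lower[of "V *v c"] \<alpha> by (smt (verit) mult_nonneg_nonneg zero_le_power2)
  also have "\<dots> = (e + V *v c) \<bullet> (A *v (e + V *v c))"
    using orth[of c] sym[of e "V *v c"]
    by (simp add: matrix_vector_right_distrib inner_add_left inner_add_right inner_commute)
  also have "e + V *v c = u - x" by (simp add: e_def flip: c)
  also have "(u - x) \<bullet> (A *v (u - x)) \<le> (2 * ?q)\<^sup>2 * (u \<bullet> (A *v u))" by (rule x(2))
  also have "u \<bullet> (A *v u) \<le> 1 / \<alpha>"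
    using norm_cauchy_schwarz[of u y] norm_matrix_inv_vector_le[OF bbA \<alpha>, of y]
    unfolding Au y u_def[symmetric] by simp
  then have "(2 * ?q)\<^sup>2 * (u \<bullet> (A *v u)) \<le> (2 * ?q)\<^sup>2 * (1 / \<alpha>)" by (intro mult_left_mono) auto
  finally have "(norm e)\<^sup>2 \<le> (2 * ?q)\<^sup>2 * (1 / \<alpha>) / \<alpha>"
    unfolding pos_le_divide_eq[OF \<alpha>] by (simp only: mult.commute)
  also have "\<dots> = (2 * ?q / \<alpha>)\<^sup>2" unfolding power_divide by (simp add: power2_eq_square)
  finally have "(norm e)\<^sup>2 \<le> (2 * ?q / \<alpha>)\<^sup>2" .
  moreover have "0 \<le> 2 * ?q / \<alpha>" using q \<alpha> by (intro divide_nonneg_pos mult_nonneg_nonneg) auto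
  ultimately have "norm e \<le> 2 * ?q / \<alpha>" by (rule power2_le_imp_le)
  then show ?thesis unfolding e_def u_def .
qed

end

section \<open>The smallest eigenvalue and the condition number\<close>

lemma norm_matrix_vector_le_norm2: "norm (M *v x) \<le> norm2 M * norm x"
  unfolding norm2_def by (rule onorm) simp

lemma norm2_le:
  assumes "\<And>x. norm (M *v x) \<le> b * norm x"
  shows "norm2 M \<le> b"
  unfolding norm2_def by (rule onorm_le) (rule assms)

lemma eigenvalue_hermitian:
  fixes A :: "complex^'n^'n"
  assumes "hermitian_mat A" "A *v x = l *s x" "x \<noteq> 0"
  shows "l = of_real (Re l)" "x \<bullet> (A *v x) = Re l * (norm x)\<^sup>2"
proof -
  have c: "cinner x (A *v x) = l * of_real ((norm x)\<^sup>2)"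
    by (simp add: assms(2) cinner_simps cinner_self)
  have "cinner x (A *v x) = cinner (A *v x) x"
    using assms(1) by (simp add: cinner_matrix_vector_mult hermitian_mat_def)
  then have "cinner x (A *v x) = cnj (cinner x (A *v x))" by (metis cinner_commute)
  then have "l = cnj l" unfolding c using assms(3) by simp
  then show "l = of_real (Re l)" by (metis Reals_cnj_iff of_real_Re)
  show "x \<bullet> (A *v x) = Re l * (norm x)\<^sup>2"
    unfolding inner_eq_Re_cinner c by simp
qed

text \<open>One eigenvector chosen per eigenvalue gives a pairwise orthogonal, hence independent and
  finite family. Finiteness gives the \<open>Min\<close> in \<open>lambda_min\<close> its
  meaning.\<close>

lemma finite_eigenvalues_hermitian:
  fixes A :: "complex^'n^'n"
  assumes A: "hermitian_mat A"
  shows "finite (eigenvalues A)"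
proof -
  obtain f where f: "\<And>l. l \<in> eigenvalues A \<Longrightarrow> f l \<noteq> 0 \<and> A *v f l = l *s f l"
    using bchoice[of "eigenvalues A" "\<lambda>l x. x \<noteq> 0 \<and> A *v x = l *s x"]
    unfolding eigenvalues_def by auto
  have real: "A *v f l = Re l *\<^sub>R f l" if "l \<in> eigenvalues A" for l
    using f[OF that] eigenvalue_hermitian(1)[OF A, of "f l" l] by (simp add: scaleR_eq_smult)
  have orth: "f k \<bullet> f l = 0" if "k \<in> eigenvalues A" "l \<in> eigenvalues A" "k \<noteq> l" for k l
  proof -
    have "(A *v f k) \<bullet> f l = f k \<bullet> (A *v f l)"
      using A by (simp add: inner_matrix_vector_mult hermitian_mat_def)
    then have "(Re k - Re l) * (f k \<bullet> f l) = 0" by (simp add: real that algebra_simps)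
    moreover have "Re k \<noteq> Re l"
      using eigenvalue_hermitian(1)[OF A, of "f k" k] eigenvalue_hermitian(1)[OF A, of "f l" l] f that
      by metis
    ultimately show ?thesis by simp
  qed
  have "inj_on f (eigenvalues A)"
    by (rule inj_onI) (metis f orth inner_eq_zero_iff)
  moreover have "finite (f ` eigenvalues A)"
  proof (rule independent_imp_finite, rule pairwise_orthogonal_independent)
    show "pairwise orthogonal (f ` eigenvalues A)"
      using orth by (auto simp: pairwise_def orthogonal_def)
    show "0 \<notin> f ` eigenvalues A" using f by auto
  qed
  ultimately show ?thesis by (simp add: finite_image_iff)
qed

text \<open>The Rayleigh quotient attains its minimum \<open>l\<close> on the unit sphere at some
  \<open>x\<close>. The form of \<open>A - l\<close> is nonnegative and vanishes at
  \<open>x\<close>, so \<open>x\<close> is an eigenvector for \<open>l\<close>, and \<open>l\<close>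
  is a lower bound for every eigenvalue.\<close>

lemma hermitian_pos_def_lambda_min:
  fixes A :: "complex^'n^'n"
  assumes A: "hermitian_pos_def A"
  obtains x where "norm x = 1" "A *v x = lambda_min A *\<^sub>R x" "0 < lambda_min A"
    "\<And>v. lambda_min A * (norm v)\<^sup>2 \<le> v \<bullet> (A *v v)"
proof -
  have herm: "hermitian_mat A" using A by (simp add: hermitian_pos_def_def)
  have sym: "(A *v x) \<bullet> y = x \<bullet> (A *v y)" for x y
    using herm by (simp add: inner_matrix_vector_mult hermitian_mat_def)
  obtain e :: "complex^'n" where "norm e = 1" using vector_choose_size[of 1] by auto
  then have "sphere (0 :: complex^'n) 1 \<noteq> {}" by auto
  moreover have "continuous_on (sphere 0 1) (\<lambda>x. x \<bullet> (A *v x))" by (intro continuous_intros)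
  ultimately obtain x where x: "norm x = 1"
    and min: "\<And>v. norm v = 1 \<Longrightarrow> x \<bullet> (A *v x) \<le> v \<bullet> (A *v v)"
    using continuous_attains_inf[of "sphere (0 :: complex^'n) 1" "\<lambda>x. x \<bullet> (A *v x)"] by auto
  define l where "l = x \<bullet> (A *v x)"
  have l: "l * (norm v)\<^sup>2 \<le> v \<bullet> (A *v v)" for v
  proof (cases "v = 0")
    case False
    then have "l \<le> sgn v \<bullet> (A *v sgn v)" unfolding l_def by (intro min) (simp add: norm_sgn)
    also have "\<dots> = (v \<bullet> (A *v v)) / (norm v)\<^sup>2"
      by (simp add: sgn_div_norm matrix_vector_mult_scaleR_right power2_eq_square divide_inverse)
    finally show ?thesis using False by (simp add: field_simps)
  qed simp
  have "A *v x - l *\<^sub>R x = 0"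
  proof (rule psd_form_zero[where P = "\<lambda>v. A *v v - l *\<^sub>R v"])
    show "linear (\<lambda>v. A *v v - l *\<^sub>R v)"
      by (intro linear_compose_sub matrix_vector_mul_linear linear_scale_self)
  qed (use sym l x in \<open>auto simp: inner_diff_left inner_diff_right power2_norm_eq_inner l_def norm_eq_1\<close>)
  then have Ax: "A *v x = l *\<^sub>R x" by simp
  have "x \<noteq> 0" using x by auto
  have "lambda_min A = l"
    unfolding lambda_min_def
  proof (rule Min_eqI)
    show "finite (Re ` eigenvalues A)" by (simp add: finite_eigenvalues_hermitian herm)
    show "l \<le> r" if r: "r \<in> Re ` eigenvalues A" for r
    proof -
      obtain k v where v: "v \<noteq> 0" "A *v v = k *s v" "r = Re k" using r by (auto simp: eigenvalues_def)
      have "l * (norm v)\<^sup>2 \<le> r * (norm v)\<^sup>2"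
        using l[of v] eigenvalue_hermitian(2)[OF herm v(2,1)] v(3) by simp
      then show ?thesis using v(1) by simp
    qed
    have "of_real l \<in> eigenvalues A" using Ax \<open>x \<noteq> 0\<close> by (auto simp: eigenvalues_def scaleR_eq_smult)
    then show "l \<in> Re ` eigenvalues A" by (force simp: image_iff)
  qed
  moreover have "0 < l"
    using A \<open>x \<noteq> 0\<close> by (simp add: hermitian_pos_def_def l_def inner_eq_Re_cinner)
  ultimately show ?thesis using that[OF x] Ax l by simp
qed

text \<open>An eigenvector for the smallest eigenvalue shows that the inverse has norm at least
  \<open>1 / lambda_min A\<close>. Below, \<open>norm2 A\<close> serves as the upper bound of the
  quadratic form.\<close>

lemma norm2_le_cond_num:
  fixes A :: "complex^'n^'n"
  assumes A: "hermitian_pos_def A"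
  shows "norm2 A \<le> cond_num A * lambda_min A" "lambda_min A \<le> norm2 A"
proof -
  obtain x where x: "norm x = 1" "A *v x = lambda_min A *\<^sub>R x" "0 < lambda_min A"
    and lower: "\<And>v. lambda_min A * (norm v)\<^sup>2 \<le> v \<bullet> (A *v v)"
    using hermitian_pos_def_lambda_min[OF A] by blast
  show le: "lambda_min A \<le> norm2 A"
    using norm_matrix_vector_le_norm2[of A x] x by simp
  have "invertible A" by (rule bounded_below_invertible[OF coercive_bounded_below[OF lower] x(3)])
  then have "x = lambda_min A *\<^sub>R (matrix_inv A *v x)"
    using matrix_inv_vector(2)[of A x] x(2) by (simp add: matrix_vector_mult_scaleR_right)
  then have "1 = lambda_min A * norm (matrix_inv A *v x)"
    using x by (metis abs_of_pos norm_scaleR)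
  also have "\<dots> \<le> lambda_min A * norm2 (matrix_inv A)"
    using norm_matrix_vector_le_norm2[of "matrix_inv A" x] x by (intro mult_left_mono) auto
  finally have "norm2 A * 1 \<le> norm2 A * (lambda_min A * norm2 (matrix_inv A))"
    using le x(3) by (intro mult_left_mono) auto
  then show "norm2 A \<le> cond_num A * lambda_min A" by (simp add: cond_num_def algebra_simps)
qed

section \<open>The Arnoldi approximation\<close>

lemma outer_mult_left: "M ** outer x y = outer (M *v x) y"
  by (simp add: vec_eq_iff outer_def matrix_matrix_mult_def matrix_vector_mult_def
      sum_distrib_right mult.assoc)

lemma outer_mult_right: "outer x y ** M = outer x (ctranspose M *v y)"
  by (simp add: vec_eq_iff outer_def matrix_matrix_mult_def matrix_vector_mult_def
      sum_distrib_left mult_ac)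

lemma outer_diff: "outer u w - outer u' w' = outer (u - u') w + outer u' (w - w')"
  by (simp add: vec_eq_iff outer_def algebra_simps)

lemma norm_cinner_le: "cmod (cinner x y) \<le> norm x * norm y"
proof -
  have "cmod (cinner x y) \<le> (\<Sum>i\<in>UNIV. norm (x $ i) * norm (y $ i))"
    unfolding cinner_def by (rule sum_norm_le) (simp add: norm_mult)
  also have "\<dots> \<le> norm x * norm y"
    using L2_set_mult_ineq[of "\<lambda>j. norm (x $ j)" "\<lambda>j. norm (y $ j)" UNIV]
    by (simp add: norm_vec_def)
  finally show ?thesis .
qed

lemma norm_outer_vector_le: "norm (outer u w *v x) \<le> norm u * norm w * norm x"
proof -
  have "outer u w *v x = cinner w x *s u"
    by (simp add: vec_eq_iff outer_def matrix_vector_mult_def cinner_def sum_distrib_left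
        sum_distrib_right mult_ac)
  then show ?thesis
    using mult_right_mono[OF norm_cinner_le[of w x], of "norm u"]
    by (simp add: norm_vector_smult mult_ac)
qed

text \<open>Changing one factor at a time splits the difference into two outer products, each of
  which costs \<open>d * b\<close>.\<close>

lemma norm_outer_diff_vector_le:
  assumes "norm (u - u') \<le> d" "norm w \<le> b" "norm u' \<le> b" "norm (w - w') \<le> d"
  shows "norm ((outer u w - outer u' w') *v x) \<le> 2 * (d * b) * norm x"
proof -
  have "0 \<le> d" "0 \<le> b" using assms(1,2) by (meson norm_ge_zero order_trans)+
  have "norm ((outer u w - outer u' w') *v x)
      \<le> norm (u - u') * norm w * norm x + norm u' * norm (w - w') * norm x"
    unfolding outer_diff matrix_vector_mult_add_rdistrib
    by (intro norm_triangle_le add_mono norm_outer_vector_le)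
  also have "\<dots> \<le> d * b * norm x + b * d * norm x"
    using assms \<open>0 \<le> d\<close> \<open>0 \<le> b\<close> by (intro add_mono mult_right_mono mult_mono) auto
  finally show ?thesis by (simp add: algebra_simps)
qed

section \<open>Krylov spaces and Arnoldi bases\<close>

lemma mem_krylov_1: "y \<in> krylov 1 A y"
  unfolding krylov_def by (rule vec.span_base) (auto intro!: exI[of _ 0])

lemma krylov_Suc_mono: "krylov j A y \<subseteq> krylov (Suc j) A y"
  unfolding krylov_def by (rule vec.span_mono) (auto intro: less_SucI)

lemma matrix_vector_mult_krylov:
  assumes "x \<in> krylov j A y"
  shows "A *v x \<in> krylov (Suc j) A y"
proof -
  have "(*v) A ` krylov j A y = vec.span ((*v) A ` {mat_pow A k *v y | k. k < j})"
    unfolding krylov_def by (simp add: vec.span_image)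
  also have "\<dots> \<subseteq> krylov (Suc j) A y"
    unfolding krylov_def
  proof (rule vec.span_mono, safe)
    fix k assume "k < j"
    then show "\<exists>l. A *v (mat_pow A k *v y) = mat_pow A l *v y \<and> l < Suc j"
      by (intro exI[of _ "Suc k"]) (simp add: matrix_vector_mul_assoc)
  qed
  finally show ?thesis using assms by blast
qed

text \<open>\<open>segment_to_id t A\<close> is a polynomial of degree at most one in
  \<open>A\<close>, so the Krylov spaces of \<open>A\<close> serve for every \<open>t\<close> at
  once.\<close>

lemma segment_to_id_krylov:
  assumes "x \<in> krylov j A y"
  shows "segment_to_id t A *v x \<in> krylov (Suc j) A y"
proof -
  have "segment_to_id t A *v x = of_real t *s (A *v x - x) + x"
    by (simp add: segment_to_id_def matrix_vector_mult_add_rdistrib scaleR_matrix_vector_mult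
        matrix_vector_mult_diff_rdistrib scaleR_eq_smult)
  moreover have "x \<in> krylov (Suc j) A y" using assms krylov_Suc_mono by blast
  ultimately show ?thesis using matrix_vector_mult_krylov[OF assms]
    unfolding krylov_def by (simp add: vec.span_add vec.span_scale vec.span_diff)
qed

lemma
  fixes V :: "complex^'m::{finite,wellorder}^'n"
  assumes V: "arnoldi_basis A y V"
  shows arnoldi_basis_isometry: "ctranspose V ** V = mat 1"
    and arnoldi_basis_range: "krylov CARD('m) A y \<subseteq> range ((*v) V)"
    and arnoldi_basis_e1: "V *v e1 = sgn y"
proof -
  show "ctranspose V ** V = mat 1" using V by (simp add: arnoldi_basis_def)
  have "vec.span (columns V) \<subseteq> range ((*v) V)"
  proof (rule vec.span_minimal)
    show "columns V \<subseteq> range ((*v) V)"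
      by (auto simp: columns_def simp flip: matrix_vector_mult_axis)
    show "vec.subspace (range ((*v) V))"
      by (rule vec.subspace_image) (rule vec.subspace_UNIV)
  qed
  then show "krylov CARD('m) A y \<subseteq> range ((*v) V)" using V by (simp add: arnoldi_basis_def)
  \<comment> \<open>The least index has no predecessors, so its column has number zero and is the
    normalised starting vector.\<close>
  have "{..<LEAST k::'m. True} = {}" using not_less_Least by fastforce
  then have "column (LEAST k. True) V = arnoldi_vec A y 0" using V by (simp add: arnoldi_basis_def)
  then show "V *v e1 = sgn y" by (simp add: e1_def matrix_vector_mult_axis arnoldi_vec.simps)
qed

section \<open>Spectral bounds along the segment\<close>

lemma segment_form:
  "x \<bullet> (segment_to_id t A *v x) = t * (x \<bullet> (A *v x)) + (1 - t) * (norm x)\<^sup>2"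
  by (simp add: segment_to_id_def matrix_vector_mult_add_rdistrib scaleR_matrix_vector_mult
      matrix_vector_mult_diff_rdistrib inner_add_right inner_diff_right power2_norm_eq_inner algebra_simps)

lemma segment_to_id_lower:
  assumes "\<And>x. \<alpha> * (norm x)\<^sup>2 \<le> x \<bullet> (A *v x)" "t \<in> {0..1}"
  shows "(t * (\<alpha> - 1) + 1) * (norm x)\<^sup>2 \<le> x \<bullet> (segment_to_id t A *v x)"
  using mult_left_mono[OF assms(1)[of x], of t] assms(2) by (simp add: segment_form algebra_simps)

lemma segment_to_id_upper:
  assumes "\<And>x. x \<bullet> (A *v x) \<le> \<beta> * (norm x)\<^sup>2" "t \<in> {0..1}"
  shows "x \<bullet> (segment_to_id t A *v x) \<le> (t * (\<beta> - 1) + 1) * (norm x)\<^sup>2"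
  using mult_left_mono[OF assms(1)[of x], of t] assms(2) by (simp add: segment_form algebra_simps)

lemma segment_pos:
  assumes "0 < \<alpha>" "t \<in> {0..1}"
  shows "0 < t * (\<alpha> - 1) + (1::real)"
proof -
  have eq: "t * (\<alpha> - 1) + 1 = t * \<alpha> + (1 - t)" by (simp add: algebra_simps)
  have "0 \<le> t * \<alpha>" using assms by simp
  then have "0 < t * \<alpha> + (1 - t)" if "t \<noteq> 1" using assms(2) that by (intro add_nonneg_pos) auto
  then show ?thesis unfolding eq using assms(1) by (cases "t = 1") auto
qed

lemma coercive_in_log_domain:
  assumes "\<And>x. \<alpha> * (norm x)\<^sup>2 \<le> x \<bullet> (A *v x)" "0 < \<alpha>"
  shows "A \<in> log_domain"
  unfolding log_domain_def
  using bounded_below_invertible[OF coercive_bounded_below[OF segment_to_id_lower[OF assms(1)]] segment_pos[OF assms(2)]]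
  by blast

text \<open>Orthonormal columns compress the identity to the identity; hence the small resolvent in
  the Arnoldi integrand is the inverse of the compressed segment matrix.\<close>

lemma segment_to_id_compression:
  assumes "ctranspose V ** V = mat 1"
  shows "ctranspose V ** segment_to_id t A ** V = segment_to_id t (ctranspose V ** A ** V)"
  by (simp add: segment_to_id_def matrix_add_ldistrib matrix_mult_add_left matrix_mult_minus_left
      matrix_mult_minus_right matrix_scalar_ac scaleR_right_diff_distrib assms
      flip: scalar_matrix_assoc)

text \<open>From \<open>\<beta> \<le> \<kappa> \<alpha>\<close> and \<open>1 \<le> \<kappa>\<close>
  the convex combinations with 1 inherit \<open>\<beta>' \<le> \<kappa> \<alpha>'\<close>, and the
  rate increases with the ratio of the bounds.\<close>

lemma cg_rate_le:
  assumes "0 < \<alpha>" "\<alpha> \<le> \<beta>" "\<beta> \<le> \<kappa> * \<alpha>" "t \<in> {0..1}"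
  defines "\<alpha>' \<equiv> t * (\<alpha> - 1) + 1" and "\<beta>' \<equiv> t * (\<beta> - 1) + 1"
  shows "((sqrt \<beta>' - sqrt \<alpha>') / (sqrt \<beta>' + sqrt \<alpha>')) ^ m \<le> ((sqrt \<kappa> - 1) / (sqrt \<kappa> + 1)) ^ m"
proof (rule power_mono)
  have \<alpha>': "0 < \<alpha>'" unfolding \<alpha>'_def using assms(1,4) by (rule segment_pos)
  have "t * \<alpha> \<le> t * \<beta>" using assms by (intro mult_left_mono) auto
  then have le: "\<alpha>' \<le> \<beta>'" by (simp add: \<alpha>'_def \<beta>'_def algebra_simps)
  then show "0 \<le> (sqrt \<beta>' - sqrt \<alpha>') / (sqrt \<beta>' + sqrt \<alpha>')" using \<alpha>' by simp
  have "1 * \<alpha> \<le> \<kappa> * \<alpha>" using assms by linarith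
  then have "1 \<le> \<kappa>" using assms(1) by (rule mult_right_le_imp_le)
  have "t * \<beta> \<le> t * (\<kappa> * \<alpha>)" "(1 - t) * 1 \<le> (1 - t) * \<kappa>"
    using mult_left_mono[OF assms(3), of t] mult_left_mono[OF \<open>1 \<le> \<kappa>\<close>, of "1 - t"] assms(4) by auto
  then have "\<beta>' \<le> \<kappa> * \<alpha>'" by (simp add: \<alpha>'_def \<beta>'_def algebra_simps)
  then have "sqrt \<beta>' \<le> sqrt \<kappa> * sqrt \<alpha>'" by (metis real_sqrt_le_iff real_sqrt_mult)
  then have "2 * sqrt \<beta>' \<le> 2 * (sqrt \<kappa> * sqrt \<alpha>')" by simp
  moreover have P: "0 < sqrt \<beta>' + sqrt \<alpha>'" "0 < sqrt \<kappa> + 1"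
    using \<alpha>' le \<open>1 \<le> \<kappa>\<close> by (auto intro: add_pos_pos add_nonneg_pos)
  ultimately show "(sqrt \<beta>' - sqrt \<alpha>') / (sqrt \<beta>' + sqrt \<alpha>') \<le> (sqrt \<kappa> - 1) / (sqrt \<kappa> + 1)"
    unfolding pos_divide_le_eq[OF P(1)] times_divide_eq_left pos_le_divide_eq[OF P(2)]
    by (simp add: algebra_simps)
qed

text \<open>The scalar counterpart of \<open>has_integral_resolvent_square\<close>, with
  antiderivative \<open>t / (t (\<alpha> - 1) + 1)\<close>.\<close>

lemma has_integral_inverse_square_segment:
  fixes \<alpha> :: real
  assumes "0 < \<alpha>"
  shows "((\<lambda>t. 1 / (t * (\<alpha> - 1) + 1)\<^sup>2) has_integral 1 / \<alpha>) {0..1}"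
proof -
  have "((\<lambda>t. t / (t * (\<alpha> - 1) + 1)) has_vector_derivative 1 / (t * (\<alpha> - 1) + 1)\<^sup>2) (at t within {0..1})"
    if "t \<in> {0..1}" for t
    using segment_pos[OF assms that]
    unfolding has_real_derivative_iff_has_vector_derivative[symmetric]
    by (auto intro!: derivative_eq_intros simp: power2_eq_square)
  from fundamental_theorem_of_calculus[OF _ this] show ?thesis by simp
qed

text \<open>Since \<open>V\<close> maps \<open>e1\<close> to \<open>y\<close>, the vector
  \<open>u'\<close> is the Galerkin solution for \<open>segment_to_id t A\<close>, whose form bounds
  are the images of \<open>lambda_min A\<close> and \<open>norm2 A\<close> under the same affine
  map.\<close>

lemma arnoldi_galerkin_error:
  fixes A :: "complex^'n^'n" and V :: "complex^'m::{finite,wellorder}^'n"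
  assumes A: "hermitian_pos_def A" and y: "norm y = 1" and V: "arnoldi_basis A y V" and t: "t \<in> {0..1}"
  defines "\<alpha> \<equiv> t * (lambda_min A - 1) + 1"
    and "u \<equiv> resolvent t A *v y" and "u' \<equiv> V *v (resolvent t (ctranspose V ** A ** V) *v e1)"
  shows "norm u \<le> 1 / \<alpha>" "norm u' \<le> 1 / \<alpha>"
    "norm (u - u') \<le> 2 * ((sqrt (cond_num A) - 1) / (sqrt (cond_num A) + 1)) ^ CARD('m) / \<alpha>"
proof -
  have pos: "0 < lambda_min A" and lower: "\<And>v. lambda_min A * (norm v)\<^sup>2 \<le> v \<bullet> (A *v v)"
    using hermitian_pos_def_lambda_min[OF A] by blast+
  have upper: "v \<bullet> (A *v v) \<le> norm2 A * (norm v)\<^sup>2" for v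
    using norm_cauchy_schwarz[of v "A *v v"] mult_left_mono[OF norm_matrix_vector_le_norm2[of A v], of "norm v"]
    by (simp add: power2_eq_square algebra_simps)
  have herm: "ctranspose (segment_to_id t A) = segment_to_id t A"
    using A by (simp add: ctranspose_segment_to_id hermitian_pos_def_def hermitian_mat_def)
  note iso = arnoldi_basis_isometry[OF V]
  have \<alpha>: "0 < \<alpha>" unfolding \<alpha>_def by (rule segment_pos[OF pos t])
  have low: "\<alpha> * (norm x)\<^sup>2 \<le> x \<bullet> (segment_to_id t A *v x)" for x
    unfolding \<alpha>_def by (rule segment_to_id_lower[OF lower t])
  have "sgn y = y" using y by (simp add: sgn_div_norm)
  then have Ve: "V *v e1 = y" by (simp add: arnoldi_basis_e1[OF V])
  then have "ctranspose V *v y = e1"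
    by (metis iso matrix_vector_mul_assoc matrix_vector_mul_lid)
  then have u': "u' = galerkin (segment_to_id t A) V y"
    by (simp add: u'_def galerkin_def resolvent_def segment_to_id_compression[OF iso])
  show "norm u \<le> 1 / \<alpha>"
    unfolding u_def resolvent_def
    using norm_matrix_inv_vector_le[OF coercive_bounded_below[OF low] \<alpha>, of y] y by simp
  have "norm (e1 :: complex^'m::{finite,wellorder}) = 1" using norm_isometry[OF iso, of e1] Ve y by simp
  then show "norm u' \<le> 1 / \<alpha>"
    using norm_galerkin_le[OF low \<alpha> iso, of e1] unfolding u' Ve by simp
  let ?\<beta> = "t * (norm2 A - 1) + 1"
  have "t * lambda_min A \<le> t * norm2 A" using t norm2_le_cond_num(2)[OF A] by (intro mult_left_mono) auto
  then have "\<alpha> \<le> ?\<beta>" by (simp add: \<alpha>_def algebra_simps)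
  have "norm (u - u') \<le> 2 * ((sqrt ?\<beta> - sqrt \<alpha>) / (sqrt ?\<beta> + sqrt \<alpha>)) ^ CARD('m) / \<alpha>"
    unfolding u' u_def resolvent_def
    by (rule galerkin_error[OF low \<alpha> iso herm segment_to_id_upper[OF upper t] \<open>\<alpha> \<le> ?\<beta>\<close> y,
          where K = "\<lambda>j. krylov j A y"])
      (use krylov_Suc_mono[of _ A y] mem_krylov_1[of y A] arnoldi_basis_range[OF V] segment_to_id_krylov[of _ _ A y t]
        in \<open>auto simp: krylov_def vec.subspace_span\<close>)
  also have "\<dots> \<le> 2 * ((sqrt (cond_num A) - 1) / (sqrt (cond_num A) + 1)) ^ CARD('m) / \<alpha>"
    unfolding \<alpha>_def
    using \<alpha> cg_rate_le[OF pos norm2_le_cond_num(2)[OF A] norm2_le_cond_num(1)[OF A] t]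
    by (intro divide_right_mono mult_left_mono) (auto simp: \<alpha>_def)
  finally show "norm (u - u') \<le> 2 * ((sqrt (cond_num A) - 1) / (sqrt (cond_num A) + 1)) ^ CARD('m) / \<alpha>" .
qed

theorem theorem8:
  fixes A :: "complex^'n^'n"
    and y z :: "complex^'n"
    and \<eta> :: complex
    and V W :: "complex^'m::{finite,wellorder}^'n"
  assumes "hermitian_pos_def A"
    and "norm y = 1" and "norm z = 1"
    and "vec.dim (krylov CARD('m::{finite,wellorder}) A y) = CARD('m::{finite,wellorder})"
    and "vec.dim (krylov CARD('m::{finite,wellorder}) (ctranspose A) z) = CARD('m::{finite,wellorder})"
    and "arnoldi_basis A y V"
    and "arnoldi_basis (ctranspose A) z W"
  shows "norm2 (frechet_deriv mat_log A (\<eta> *sm outer y z) - arnoldi_approx A \<eta> y z V W)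
    \<le> 4 * cmod \<eta> / lambda_min A *
      ((sqrt (cond_num A) - 1) / (sqrt (cond_num A) + 1)) ^ CARD('m::{finite,wellorder})"
proof -
  let ?q = "((sqrt (cond_num A) - 1) / (sqrt (cond_num A) + 1)) ^ CARD('m)"
  let ?\<alpha> = "\<lambda>t. t * (lambda_min A - 1) + 1"
  have herm: "ctranspose A = A" using assms(1) by (simp add: hermitian_pos_def_def hermitian_mat_def)
  have V: "arnoldi_basis A y V" and W: "arnoldi_basis A z W" using assms(6,7) by (simp_all add: herm)
  have pos: "0 < lambda_min A" and lower: "\<And>v. lambda_min A * (norm v)\<^sup>2 \<le> v \<bullet> (A *v v)"
    using hermitian_pos_def_lambda_min[OF assms(1)] by blast+
  have dom: "A \<in> log_domain" by (rule coercive_in_log_domain[OF lower pos])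
  have domc: "ctranspose U ** A ** U \<in> log_domain" if "ctranspose U ** U = mat 1" for U :: "complex^'m::{finite,wellorder}^'n"
    by (rule coercive_in_log_domain[OF compression_coercive[OF lower pos that] pos])
  have hermr: "ctranspose (resolvent t B) = resolvent t B"
    if "B \<in> log_domain" "ctranspose B = B" "t \<in> {0..1}" for t and B :: "complex^'k^'k"
    using that by (simp add: resolvent_def ctranspose_matrix_inv log_domain_def ctranspose_segment_to_id)
  let ?G = "ctranspose V ** A ** V" and ?H = "ctranspose W ** A ** W"
  have G: "?G \<in> log_domain" and H: "?H \<in> log_domain" "ctranspose ?H = ?H"
    by (auto intro!: domc arnoldi_basis_isometry[OF V] arnoldi_basis_isometry[OF W])
      (simp add: ctranspose_mult herm matrix_mul_assoc)
  define u w where "u t = resolvent t A *v y" and "w t = resolvent t A *v z" for t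
  define u' w' where "u' t = V *v (resolvent t ?G *v e1)" and "w' t = W *v (resolvent t ?H *v e1)" for t
  let ?f = "\<lambda>t. resolvent t A ** outer y z ** resolvent t A"
  let ?g = "\<lambda>t. resolvent t ?G ** outer e1 e1 ** resolvent t ?H"
  let ?g' = "\<lambda>t. V ** ?g t ** ctranspose W"
  have intf: "?f integrable_on {0..1}" by (rule integrable_sandwich[OF dom dom])
  have intg: "?g integrable_on {0..1}" by (rule integrable_sandwich[OF G H(1)])
  have intg': "?g' integrable_on {0..1}"
    by (intro integrable_continuous_interval continuous_intros continuous_on_resolvent G H)
  \<comment> \<open>Hermitian symmetry moves the right resolvent onto the second vector, so each
    integrand is a single outer product.\<close>
  have f: "?f t = outer (u t) (w t)" and g: "?g' t = outer (u' t) (w' t)" if t: "t \<in> {0..1}" for t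
    by (simp_all add: outer_mult_left outer_mult_right hermr[OF dom herm t] hermr[OF H t]
        u_def w_def u'_def w'_def)
  have "arnoldi_approx A \<eta> y z V W = \<eta> *sm (V ** integral {0..1} ?g ** ctranspose W)"
    unfolding arnoldi_approx_def Let_def herm H(2)
    by (simp add: assms(2,3) resolvent_def segment_to_id_def)
  also have "V ** integral {0..1} ?g ** ctranspose W = integral {0..1} ?g'"
  proof -
    have "(\<lambda>t. V ** ?g t) integrable_on {0..1}"
      by (intro integrable_continuous_interval continuous_intros continuous_on_resolvent G H)
    then show ?thesis by (simp add: integral_matrix_mult_right integral_matrix_mult_left[OF intg])
  qed
  finally have approx: "arnoldi_approx A \<eta> y z V W = \<eta> *sm integral {0..1} ?g'" .
  have "frechet_deriv mat_log A (\<eta> *sm outer y z) = \<eta> *sm integral {0..1} ?f"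
    unfolding frechet_deriv_mat_log[OF dom] log_deriv_def smult_mat_mult
    using integral_linear[OF intf bounded_linear_smult_mat[of \<eta>]] by (simp add: o_def)
  then have diff: "frechet_deriv mat_log A (\<eta> *sm outer y z) - arnoldi_approx A \<eta> y z V W
      = \<eta> *sm integral {0..1} (\<lambda>t. ?f t - ?g' t)"
    unfolding approx integral_diff[OF intf intg']
    by (simp add: vec_eq_iff algebra_simps)
  have intfg: "(\<lambda>t. ?f t - ?g' t) integrable_on {0..1}" by (rule integrable_diff[OF intf intg'])
  show ?thesis
    unfolding diff
  \<comment> \<open>The estimate is made after application to a vector, because the norm of a
    matrix-valued integrand would be the Frobenius norm.\<close>
  proof (rule norm2_le)
    fix x :: "complex^'n"
    have "((\<lambda>t. 4 * ?q * norm x * (1 / (?\<alpha> t)\<^sup>2)) has_integral 4 * ?q * norm x * (1 / lambda_min A)) {0..1}"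
      by (intro has_integral_mult_right has_integral_inverse_square_segment pos)
    then have int: "(\<lambda>t. 4 * ?q * norm x * (1 / (?\<alpha> t)\<^sup>2)) integrable_on {0..1}"
      and val: "integral {0..1} (\<lambda>t. 4 * ?q * norm x * (1 / (?\<alpha> t)\<^sup>2)) = 4 * ?q * norm x * (1 / lambda_min A)"
      by (auto simp: integral_unique)
    have "norm (integral {0..1} (\<lambda>t. ?f t - ?g' t) *v x)
        = norm (integral {0..1} (\<lambda>t. (?f t - ?g' t) *v x))"
      by (simp only: integral_matrix_vector_mult[OF intfg])
    also have "\<dots> \<le> integral {0..1} (\<lambda>t. 4 * ?q * norm x * (1 / (?\<alpha> t)\<^sup>2))"
    proof (rule integral_norm_bound_integral[OF _ int])
      show "(\<lambda>t. (?f t - ?g' t) *v x) integrable_on {0..1}"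
        by (intro integrable_continuous_interval continuous_intros continuous_on_resolvent dom G H)
      fix t :: real assume t: "t \<in> {0..1}"
      note Y = arnoldi_galerkin_error[OF assms(1,2) V t, folded u_def u'_def]
        and Z = arnoldi_galerkin_error[OF assms(1,3) W t, folded w_def w'_def]
      \<comment> \<open>Each of the two factors contributes an error \<open>2 q / \<alpha>_t\<close>
        times a norm \<open>1 / \<alpha>_t\<close>; their sum explains the constant 4.\<close>
      show "norm ((?f t - ?g' t) *v x) \<le> 4 * ?q * norm x * (1 / (?\<alpha> t)\<^sup>2)"
        unfolding f[OF t] g[OF t]
        using norm_outer_diff_vector_le[OF Y(3) Z(1) Y(2) Z(3), of x]
        by (simp add: power2_eq_square)
    qed
    also have "\<dots> = 4 * ?q * norm x * (1 / lambda_min A)" by (rule val)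
    finally have "cmod \<eta> * norm (integral {0..1} (\<lambda>t. ?f t - ?g' t) *v x)
        \<le> cmod \<eta> * (4 * ?q * norm x * (1 / lambda_min A))"
      by (rule mult_left_mono) simp
    then show "norm ((\<eta> *sm integral {0..1} (\<lambda>t. ?f t - ?g' t)) *v x)
        \<le> 4 * cmod \<eta> / lambda_min A * ?q * norm x"
      by (simp add: smult_mat_vector_mult norm_vector_smult mult_ac)
  qed
qed

end
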